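(* Let $\Gamma$ be a game with incomplete information as described in the context, in which every action space $A_i$ ($i\in I$) is uncountable. If Assumptions (P'), (I) and (RD) hold, then $\Gamma$ has a pure strategy equilibrium, i.e. there exist $\mathcal T_i$-measurable maps $f_i^*:T_i\to A_i$, $i\in I$, such that for every $i\in I$, $f_i^*$ maximizes $U_i(f_i,f_{-i}^* )$ over all $\mathcal T_i$-measurable maps $f_i:T_i\to A_i$.
   Context: Game with incomplete information: players $I=\{1,\dots,n\}$. Each player $i$ has an action space $A_i$, a compact metric space; $A=\prod_{i\in I}A_i$ with Borel $\sigma$-algebra $\mathcal B(A)$. Each player $i$ has an information space $(T_i,\mathcal T_i,\lambda_i)$, an atomless probability space with $\lambda_i$ complete and countably additive; $T=\prod_i T_i$, $\mathcal T=\bigotimes_i\mathcal T_i$, and $\lambda$ is a probability measure on $(T,\mathcal T)$ whose marginal on $T_i$ is $\lambda_i$. For each $i$, $\mathcal F_i\subseteq\mathcal T_i$ is a sub-$\sigma$-algebra (the payoff-relevant information). Player $i$ has a payoff function $u_i:A\times T_i\to\mathbb R$. $\mathcal M(A_i)$ denotes the space of Borel probability measures on $A_i$ with the topology of weak convergence. A mixed strategy of $i$ is a $\mathcal T_i$-measurable map $f_i:T_i\to\mathcal M(A_i)$ (write $f_i(t_i,\cdot)$ for the measure); a pure strategy is a $\mathcal T_i$-measurable map $f_i:T_i\to A_i$, identified with the mixed strategy $t_i\mapsto\delta_{f_i(t_i)}$. For a strategy profile $f=(f_1,\dots,f_n)$ and $E\in\mathcal T_i$, $U_i^E(f)=\int_{E\times\prod_{j\ne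 i}T_j}\int_A u_i(a_1,\dots,a_n,t_i)\prod_{j\in I}f_j(t_j,\mathrm d a_j)\,\mathrm d\lambda(t)$, and $U_i(f)=U_i^{T_i}(f)$. Assumption (I): $\lambda=\bigotimes_{i\in I}\lambda_i$. Assumption (P'): for each $i$, $\mathcal F_i$ is countably generated; $u_i$ is $\mathcal B(A)\otimes\mathcal F_i$-measurable; $u_i(\cdot,t_i)$ is continuous on $A$ for every $t_i\in T_i$; and there is a real-valued function $h_i$ integrable on $(T_i,\mathcal F_i,\lambda_i)$ with $|u_i|\le h_i$ on $A\times T_i$. Nowhere equivalence: $\mathcal T_i$ is nowhere equivalent to $\mathcal F_i$ if for every $D\in\mathcal T_i$ with $\lambda_i(D)>0$ there is a $\mathcal T_i$-measurable $D_0\subseteq D$ such that $\lambda_i(D_0\triangle D_1)>0$ for every $D_1\in\mathcal F_i^D:=\{D\cap D':D'\in\mathcal F_i\}$. Assumption (RD): for each $i$, $\mathcal T_i$ is atomless and nowhere equivalent to $\mathcal F_i$. *)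

theory Defs
  imports "HOL-Analysis.Analysis" "HOL-Probability.Probability"
begin

definition atomless :: "'t measure \<Rightarrow> bool" where
  "atomless M \<longleftrightarrow>
     (\<forall>D\<in>sets M. emeasure M D > 0 \<longrightarrow>
        (\<exists>E\<in>sets M. E \<subseteq> D \<and> 0 < emeasure M E \<and> emeasure M E < emeasure M D))"

definition countably_generated :: "'t measure \<Rightarrow> bool" where
  "countably_generated F \<longleftrightarrow>
     (\<exists>G. countable G \<and> G \<subseteq> Pow (space F) \<and> sets F = sigma_sets (space F) G)"

definition nowhere_equivalent :: "'t measure \<Rightarrow> 't measure \<Rightarrow> bool" where
  "nowhere_equivalent M F \<longleftrightarrow>
     (\<forall>D\<in>sets M. measure M D > 0 \<longrightarrow>
        (\<exists>D0\<in>sets M. D0 \<subseteq> D \<and>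
           (\<forall>D'\<in>sets F. measure M ((D0 - (D \<inter> D')) \<union> ((D \<inter> D') - D0)) > 0)))"

definition action_space :: "'a::topological_space set \<Rightarrow> 'a measure" where
  "action_space S = restrict_space borel S"

definition pure_strategies :: "'t measure \<Rightarrow> 'a::topological_space set \<Rightarrow> ('t \<Rightarrow> 'a) set" where
  "pure_strategies Ti Ai = measurable Ti (action_space Ai)"

definition payoff ::
  "'i set \<Rightarrow> ('i \<Rightarrow> 't) measure \<Rightarrow> (('i \<Rightarrow> 'a) \<Rightarrow> 't \<Rightarrow> real) \<Rightarrow> 'i \<Rightarrow> ('i \<Rightarrow> 't \<Rightarrow> 'a) \<Rightarrow> real" where
  "payoff I lam ui i f = (\<integral>t. ui (\<lambda>j\<in>I. f j (t j)) (t i) \<partial>lam)"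

definition pure_equilibrium ::
  "'i set \<Rightarrow> ('i \<Rightarrow> 'a::topological_space set) \<Rightarrow> ('i \<Rightarrow> 't measure) \<Rightarrow> ('i \<Rightarrow> 't) measure
    \<Rightarrow> ('i \<Rightarrow> ('i \<Rightarrow> 'a) \<Rightarrow> 't \<Rightarrow> real) \<Rightarrow> ('i \<Rightarrow> 't \<Rightarrow> 'a) \<Rightarrow> bool" where
  "pure_equilibrium I A T lam u f \<longleftrightarrow>
     (\<forall>i\<in>I. f i \<in> pure_strategies (T i) (A i)) \<and>
     (\<forall>i\<in>I. \<forall>g\<in>pure_strategies (T i) (A i).
        payoff I lam (u i) i (f(i := g)) \<le> payoff I lam (u i) i f)"

end

theory Submission
  imports Defs "HOL-Library.Diagonal_Subsequence"
begin

text \<open>By independence the opponents enter a player's payoff only through the laws of their actions.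
  The action sets are discretized by finite-range Borel maps \<open>\<rho> n\<close> with \<open>\<rho> n \<circ> \<rho> k = \<rho> n\<close> for
  \<open>n \<le> k\<close>. In the discretized game smoothed best replies are measurable with respect to the
  payoff-relevant information, and Brouwer's theorem gives a fixed point of their laws, hence an
  approximate equilibrium in mixed strategies. Nowhere equivalence yields a conditional Lyapunov
  theorem, by which every such mixed strategy is purified without changing its conditional law.
  A sequence of pure approximate equilibria has a subsequence along which the conditional laws of
  the discretized actions converge weakly; the conditional Lyapunov theorem, applied along the tree
  of discretization cells, realizes the limits by pure strategies, and payoffs are continuous
  under this convergence.\<close>

text \<open>The obstacle is that a weak limit of pure strategies is in general only a mixed
  strategy. What rescues purity is that player i's utility sees the type only through an
  F_i-measurable integrand: for the player's own payoff a strategy matters through its conditional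
  law given F_i, for everybody else through its unconditional law. The conditional law of a
  finite-valued action is a finite vector of F_i-measurable weights, and since F_i is countably
  generated it is tested by countably many numbers; this is the source of compactness. Nowhere
  equivalence says that every event carries randomness not explained by F_i, enough to split the
  event in any prescribed F_i-measurable proportions. Smoothing makes best replies single-valued and
  continuous in the opponents' laws, so that a point-valued fixed point theorem suffices; its cost
  \<epsilon> vanishes in the limit. The discretizations are nested because separate realizations at
  each level would be unrelated functions: only coherent ones converge pointwise to a
  strategy.\<close>

section \<open>Diagonal extraction and a fixed point theorem in coordinates\<close>

text \<open>Sequential compactness of a countable product, by a diagonal subsequence. It serves for
  grid points in a cube, for action profiles, and for the countably many probabilities that encode
  conditional laws.\<close>

lemma countable_family_convergent_subsequence:
  fixes x :: "nat \<Rightarrow> 'j \<Rightarrow> 'b::metric_space"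
  assumes J: "countable J" and K: "\<And>j. j \<in> J \<Longrightarrow> compact (K j)"
    and x: "\<And>k j. j \<in> J \<Longrightarrow> x k j \<in> K j"
  obtains r l where "strict_mono r"
    and "\<And>j. j \<in> J \<Longrightarrow> l j \<in> K j \<and> (\<lambda>k. x (r k) j) \<longlonglongrightarrow> l j"
proof (cases "J = {}")
  case True
  then show ?thesis using that[of id] by (auto simp: strict_mono_def)
next
  case False
  then obtain e :: "nat \<Rightarrow> 'j" where e: "range e = J"
    using J by (metis uncountable_def)
  define P where "P n s \<longleftrightarrow> (\<exists>l\<in>K (e n). (\<lambda>k. x (s k) (e n)) \<longlonglongrightarrow> l)" for n and s :: "nat \<Rightarrow> nat"
  interpret subseqs P
  proof
    fix n and s :: "nat \<Rightarrow> nat"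
    have "seq_compact (K (e n))" using K e by (metis rangeI compact_eq_seq_compact_metric)
    moreover have "\<forall>k. x (s k) (e n) \<in> K (e n)" using x e by blast
    ultimately obtain l r where "l \<in> K (e n)" "strict_mono (r::nat\<Rightarrow>nat)"
        "((\<lambda>k. x (s k) (e n)) \<circ> r) \<longlonglongrightarrow> l"
      by (rule seq_compactE)
    then show "\<exists>r'. strict_mono r' \<and> P n (s \<circ> r')"
      unfolding P_def by (auto simp: o_def)
  qed
  have "P n (diagseq \<circ> ((+) (Suc n)))" for n
  proof (rule diagseq_holds)
    fix r s :: "nat \<Rightarrow> nat" and n
    assume r: "strict_mono r" and "P n s"
    then obtain l where l: "l \<in> K (e n)" "(\<lambda>k. x (s k) (e n)) \<longlonglongrightarrow> l" by (auto simp: P_def)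
    from LIMSEQ_subseq_LIMSEQ[OF l(2) r] l(1) show "P n (s \<circ> r)" by (auto simp: P_def o_def)
  qed
  then have "\<exists>l\<in>K (e n). (\<lambda>k. x (diagseq (Suc n + k)) (e n)) \<longlonglongrightarrow> l" for n
    by (simp add: P_def o_def)
  then have "\<exists>l\<in>K (e n). (\<lambda>k. x (diagseq k) (e n)) \<longlonglongrightarrow> l" for n
    using LIMSEQ_offset[where f="\<lambda>k. x (diagseq k) (e n)" and k="Suc n" for n] by (metis (no_types, lifting) add.commute ext)
  then have "\<forall>j\<in>J. \<exists>l. l \<in> K j \<and> (\<lambda>k. x (diagseq k) j) \<longlonglongrightarrow> l" using e by blast
  then obtain l where "\<And>j. j \<in> J \<Longrightarrow> l j \<in> K j \<and> (\<lambda>k. x (diagseq k) j) \<longlonglongrightarrow> l j" by metis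
  with subseq_diagseq show ?thesis by (rule that)
qed

text \<open>The dimension \<open>J\<close> is a set rather than a type, hence continuity is stated along coordinatewise
  convergent sequences.\<close>

lemma brouwer_finite_cube:
  fixes f :: "('j \<Rightarrow> real) \<Rightarrow> 'j \<Rightarrow> real"
  assumes J: "finite J"
    and range: "\<And>x j. x \<in> J \<rightarrow> {0..1} \<Longrightarrow> j \<in> J \<Longrightarrow> f x j \<in> {0..1}"
    and cont: "\<And>X x j. (\<And>n. X n \<in> J \<rightarrow> {0..1}) \<Longrightarrow> x \<in> J \<rightarrow> {0..1} \<Longrightarrow>
      (\<And>i. i \<in> J \<Longrightarrow> (\<lambda>n. X n i) \<longlonglongrightarrow> x i) \<Longrightarrow> j \<in> J \<Longrightarrow> (\<lambda>n. f (X n) j) \<longlonglongrightarrow> f x j"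
  obtains x where "x \<in> J \<rightarrow> {0..1}" "\<And>j. j \<in> J \<Longrightarrow> f x j = x j"
proof -
  define n where "n = card J"
  obtain h where h: "bij_betw h {..<n} J"
    using ex_bij_betw_nat_finite[OF J] by (auto simp: n_def atLeast0LessThan)
  define g where "g = the_inv_into {..<n} h"
  have gh: "g (h i) = i" if "i < n" for i
    unfolding g_def using h that by (auto simp: bij_betw_def the_inv_into_f_f)
  have hg: "h (g j) = j" "g j < n" if "j \<in> J" for j
    using h that unfolding g_def
    by (auto simp: bij_betw_def f_the_inv_into_f dest: the_inv_into_into[where x=j and B="{..<n}"])
  have hJ: "h i \<in> J" if "i < n" for i using h that by (auto simp: bij_betw_def)
  define pt where "pt p y = (\<lambda>j. real (y (g j)) / real (Suc p))" for p :: nat and y :: "nat \<Rightarrow> nat"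
  \<comment> \<open>Label 0 says that \<open>f\<close> does not lower coordinate \<open>i\<close> at
    the grid point, label 1 that it does not raise it. The clause \<open>y i < Suc p\<close> forces
    label 1 on the upper face, as Kuhn's lemma demands; there \<open>f\<close> cannot raise the
    coordinate because its values are at most 1.\<close>
  define label where "label p y i =
    (if y i < Suc p \<and> f (pt p y) (h i) \<ge> real (y i) / real (Suc p) then 0 else 1::nat)" for p y i
  have pt_cube: "pt p y \<in> J \<rightarrow> {0..1}" if "\<forall>i<n. y i \<le> Suc p" for p y
    using that hg by (fastforce simp: pt_def divide_simps)
  have lab0: "f (pt p y) (h i) \<ge> pt p y (h i)" if "label p y i = 0" "i < n" for p y i
    using that by (auto simp: label_def pt_def gh split: if_splits)
  have lab1: "f (pt p y) (h i) \<le> pt p y (h i)" if "label p y i \<noteq> 0" "i < n" "\<forall>i<n. y i \<le> Suc p" for p y i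
  proof (cases "y i < Suc p")
    case True then show ?thesis using that by (auto simp: label_def pt_def gh split: if_splits)
  next
    case False
    then have "y i = Suc p" using that by (simp add: le_antisym)
    then have "pt p y (h i) = 1" using that by (simp add: pt_def gh)
    then show ?thesis using range[OF pt_cube[OF that(3)] hJ[OF that(2)]] by simp
  qed
  have "\<exists>q r s. (\<forall>i<n. q i < Suc p) \<and> (\<forall>i<n. (\<forall>j<n. q j \<le> r i j \<and> r i j \<le> q j + 1) \<and>
          (\<forall>j<n. q j \<le> s i j \<and> s i j \<le> q j + 1) \<and> label p (r i) i \<noteq> label p (s i) i)" for p
  proof -
    have 0: "\<forall>x. (\<forall>i<n. x i \<le> Suc p) \<longrightarrow> (\<forall>i<n. x i = 0 \<longrightarrow> label p x i = 0)"
      using range[OF pt_cube hJ] by (auto simp: label_def)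
    have 1: "\<forall>x. (\<forall>i<n. x i \<le> Suc p) \<longrightarrow> (\<forall>i<n. label p x i = 0 \<or> label p x i = 1)"
      by (simp add: label_def)
    have 2: "\<forall>x. (\<forall>i<n. x i \<le> Suc p) \<longrightarrow> (\<forall>i<n. x i = Suc p \<longrightarrow> label p x i = 1)"
      by (simp add: label_def)
    obtain q where "\<forall>i<n. q i < Suc p"
      "\<forall>i<n. \<exists>r s. (\<forall>j<n. q j \<le> r j \<and> r j \<le> q j + 1) \<and> (\<forall>j<n. q j \<le> s j \<and> s j \<le> q j + 1) \<and>
        label p r i \<noteq> label p s i"
      by (rule kuhn_lemma[OF zero_less_Suc 1 0 2])
    then show ?thesis by metis
  qed
  then obtain q r s where q: "\<And>p i. i < n \<Longrightarrow> q p i < Suc p"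
    and rq: "\<And>p i j. i < n \<Longrightarrow> j < n \<Longrightarrow> q p j \<le> r p i j \<and> r p i j \<le> q p j + 1"
    and sq: "\<And>p i j. i < n \<Longrightarrow> j < n \<Longrightarrow> q p j \<le> s p i j \<and> s p i j \<le> q p j + 1"
    and lab: "\<And>p i. i < n \<Longrightarrow> label p (r p i) i \<noteq> label p (s p i) i"
    by metis
  \<comment> \<open>In Kuhn's cube \<open>q p\<close> each coordinate \<open>i\<close> has two
    vertices with different labels; \<open>a p i\<close> is the one with label 0 and
    \<open>b p i\<close> the one with label 1.\<close>
  define a where "a p i = (if label p (r p i) i = 0 then r p i else s p i)" for p i
  define b where "b p i = (if label p (r p i) i = 0 then s p i else r p i)" for p i
  have lab01: "label p y i = 0 \<or> label p y i = 1" for p y i by (simp add: label_def)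
  have a0: "label p (a p i) i = 0" and b1: "label p (b p i) i \<noteq> 0" if "i < n" for p i
    using lab[OF that, of p] lab01[of p "r p i" i] lab01[of p "s p i" i] by (auto simp: a_def b_def)
  have aq: "q p j \<le> a p i j \<and> a p i j \<le> q p j + 1" and bq: "q p j \<le> b p i j \<and> b p i j \<le> q p j + 1"
    if "i < n" "j < n" for p i j
    using rq[OF that] sq[OF that] by (auto simp: a_def b_def)
  have aS: "\<forall>j<n. a p i j \<le> Suc p" and bS: "\<forall>j<n. b p i j \<le> Suc p" if "i < n" for p i
  proof -
    have "a p i j \<le> Suc p \<and> b p i j \<le> Suc p" if j: "j < n" for j
      using aq[OF \<open>i < n\<close> j, of p] bq[OF \<open>i < n\<close> j, of p] q[OF j, of p] by linarith
    then show "\<forall>j<n. a p i j \<le> Suc p" "\<forall>j<n. b p i j \<le> Suc p" by auto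
  qed
  have qc: "pt p (q p) j \<in> {0..1}" if "j \<in> J" for p j
    using q[OF hg(2)[OF that], of p] by (auto simp: pt_def divide_simps)
  obtain R l where R: "strict_mono R"
    and l: "\<And>j. j \<in> J \<Longrightarrow> l j \<in> {0..1} \<and> (\<lambda>k. pt (R k) (q (R k)) j) \<longlonglongrightarrow> l j"
    using countable_family_convergent_subsequence[where J=J and K="\<lambda>_. {0..1::real}" and x="\<lambda>p. pt p (q p)",
        OF countable_finite[OF J]] qc by auto
  \<comment> \<open>The cubes have side \<open>1 / Suc p\<close>, so all their vertices share the
    limit \<open>l\<close> of the corners. At \<open>l\<close> the inequalities at the vertices
    \<open>a\<close> and \<open>b\<close> meet in an equality.\<close>
  have near: "(\<lambda>k. pt (R k) (c (R k)) j) \<longlonglongrightarrow> l j"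
    if "\<And>p. q p (g j) \<le> c p (g j) \<and> c p (g j) \<le> q p (g j) + 1" "j \<in> J" for c j
  proof -
    have "(\<lambda>k. 1 / real (Suc (R k))) \<longlonglongrightarrow> 0"
      using LIMSEQ_subseq_LIMSEQ[OF LIMSEQ_Suc[OF lim_1_over_n] R] by (simp add: o_def)
    from tendsto_add[OF l[OF that(2), THEN conjunct2] this]
    have up: "(\<lambda>k. pt (R k) (q (R k)) j + 1 / real (Suc (R k))) \<longlonglongrightarrow> l j" by simp
    have "pt p (q p) j \<le> pt p (c p) j \<and> pt p (c p) j \<le> pt p (q p) j + 1 / real (Suc p)" for p
      using that(1)[of p] by (simp add: pt_def add_divide_distrib[symmetric] divide_right_mono)
    then show ?thesis
      by (intro tendsto_sandwich[OF _ _ l[OF that(2), THEN conjunct2] up]) auto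
  qed
  have "f l j = l j" if j: "j \<in> J" for j
  proof -
    let ?i = "g j"
    have i: "?i < n" "h ?i = j" using hg[OF j] by auto
    have lc: "l \<in> J \<rightarrow> {0..1}" using l by auto
    have na: "(\<lambda>k. pt (R k) (a (R k) ?i) m) \<longlonglongrightarrow> l m" if "m \<in> J" for m
      using near[of m "\<lambda>p. a p ?i"] aq[OF i(1) hg(2)[OF that]] that by auto
    have nb: "(\<lambda>k. pt (R k) (b (R k) ?i) m) \<longlonglongrightarrow> l m" if "m \<in> J" for m
      using near[of m "\<lambda>p. b p ?i"] bq[OF i(1) hg(2)[OF that]] that by auto
    have "(\<lambda>k. f (pt (R k) (a (R k) ?i)) j) \<longlonglongrightarrow> f l j"
      by (rule cont[OF pt_cube[OF aS[OF i(1)]] lc na j])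
    then have 1: "l j \<le> f l j"
      by (rule LIMSEQ_le[OF na[OF j]]) (use lab0[OF a0[OF i(1)] i(1)] i in auto)
    have "(\<lambda>k. f (pt (R k) (b (R k) ?i)) j) \<longlonglongrightarrow> f l j"
      by (rule cont[OF pt_cube[OF bS[OF i(1)]] lc nb j])
    then have 2: "f l j \<le> l j"
      by (rule LIMSEQ_le[OF _ nb[OF j]]) (use lab1[OF b1[OF i(1)] i(1) bS[OF i(1)]] i in auto)
    from 1 2 show ?thesis by simp
  qed
  then show ?thesis using that[of l] l by auto
qed

section \<open>Nested finite discretizations of a compact metric space\<close>

text \<open>Points are grouped by which balls of a finite family \<open>B n\<close> contain them,
  and \<open>\<rho> n\<close> sends a point to a representative of its group. As \<open>B n\<close>
  grows with \<open>n\<close>, the grouping at level \<open>k\<close> refines the one at level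
  \<open>n \<le> k\<close>, which yields the composition law.\<close>

lemma compact_finite_range_retractions:
  fixes A :: "'a::metric_space set"
  assumes "compact A"
  obtains \<rho> :: "nat \<Rightarrow> 'a \<Rightarrow> 'a" where
    "\<And>n. \<rho> n \<in> measurable (restrict_space borel A) (restrict_space borel A)"
    "\<And>n. finite (\<rho> n ` A)"
    "\<And>n k a. n \<le> k \<Longrightarrow> a \<in> A \<Longrightarrow> \<rho> n (\<rho> k a) = \<rho> n a"
    "\<And>\<epsilon>. \<epsilon> > 0 \<Longrightarrow> \<exists>N. \<forall>n\<ge>N. \<forall>a\<in>A. dist (\<rho> n a) a < \<epsilon>"
proof -
  have "\<forall>m. \<exists>D. finite D \<and> A \<subseteq> (\<Union>x\<in>D. ball x (inverse (real (Suc m))))"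
  proof
    fix m
    obtain D where "D \<subseteq> A" "finite D" "A \<subseteq> (\<Union>x\<in>D. ball x (inverse (real (Suc m))))"
    proof (rule compactE_image[OF assms, of A "\<lambda>x. ball x (inverse (real (Suc m)))"])
      show "A \<subseteq> (\<Union>x\<in>A. ball x (inverse (real (Suc m))))"
        using centre_in_ball by fastforce
    qed auto
    then show "\<exists>D. finite D \<and> A \<subseteq> (\<Union>x\<in>D. ball x (inverse (real (Suc m))))" by blast
  qed
  then obtain D where D: "\<And>m. finite (D m)"
    "\<And>m. A \<subseteq> (\<Union>x\<in>D m. ball x (inverse (real (Suc m))))" by metis
  define B where "B n = (\<Union>m<n. (\<lambda>x. ball x (inverse (real (Suc m)))) ` D m)" for n
  have finB: "finite (B n)" for n using D(1) by (auto simp: B_def)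
  have Bmono: "B n \<subseteq> B k" if "n \<le> k" for n k using that by (fastforce simp: B_def)
  have Bopen: "U \<in> B n \<Longrightarrow> open U" for U n by (auto simp: B_def)
  define c where "c n a = {U \<in> B n. a \<in> U}" for n a
  \<comment> \<open>The choice depends on \<open>a\<close> only through the pattern
    \<open>c n a\<close>: points with equal patterns receive the same representative, and there are
    only finitely many patterns.\<close>
  define \<rho> where "\<rho> n a = (SOME a'. a' \<in> A \<and> c n a' = c n a)" for n a
  have \<rho>: "\<rho> n a \<in> A \<and> c n (\<rho> n a) = c n a" if "a \<in> A" for n a
    unfolding \<rho>_def by (rule someI[of _ a]) (use that in simp)
  have \<rho>_eq: "\<rho> n a = \<rho> n b" if "c n a = c n b" for n a b using that by (simp add: \<rho>_def)
  show ?thesis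
  proof
    show fin: "finite (\<rho> n ` A)" for n
    proof -
      have "\<rho> n ` A \<subseteq> (\<lambda>S. SOME a'. a' \<in> A \<and> c n a' = S) ` Pow (B n)"
        by (auto simp: \<rho>_def c_def)
      then show ?thesis using finB by (meson finite_Pow_iff finite_imageI finite_subset)
    qed
    show "\<rho> n \<in> measurable (restrict_space borel A) (restrict_space borel A)" for n
    proof (rule measurableI)
      show "\<rho> n x \<in> space (restrict_space borel A)" if "x \<in> space (restrict_space borel A)" for x
        using that \<rho> by (simp add: space_restrict_space)
    next
      fix S :: "'a set"
      have cell: "{a. c n a = P} \<in> sets borel" for P
      proof (cases "P \<subseteq> B n")
        case True
        then have "{a. c n a = P} = (\<Inter>U\<in>P. U) \<inter> (\<Inter>U\<in>B n - P. - U)"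
          by (fastforce simp: c_def)
        moreover have "\<dots> \<in> sets borel"
        proof (intro sets.Int)
          have "finite P" using True finB finite_subset by blast
          moreover have "U \<in> sets borel" if "U \<in> P" for U using that True Bopen by auto
          ultimately show "(\<Inter>U\<in>P. U) \<in> sets borel"
            by (cases "P = {}") (use sets.finite_INT[of P "\<lambda>U. U" borel] in auto)
          show "(\<Inter>U\<in>B n - P. - U) \<in> sets borel"
          proof (cases "B n - P = {}")
            case True
            then show ?thesis by (simp only: image_empty Inter_empty) simp
          next
            case False
            then show ?thesis using finB[of n] Bopen[of _ n] by (intro sets.finite_INT) auto
          qed
        qed
        ultimately show ?thesis by simp
      next
        case False
        then have "{a. c n a = P} = {}" by (auto simp: c_def)
        then show ?thesis by simp
      qed
      \<comment> \<open>The map is constant on pattern cells, so the preimage of any set whatsoever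
        is, within \<open>A\<close>, a finite union of cells. Cells are Borel as intersections of
        finitely many open and closed sets.\<close>
      define Q where "Q = {P \<in> Pow (B n). \<exists>a\<in>A. c n a = P \<and> \<rho> n a \<in> S}"
      have Q: "\<rho> n x \<in> S \<longleftrightarrow> c n x \<in> Q" if x: "x \<in> A" for x
      proof
        show "c n x \<in> Q" if "\<rho> n x \<in> S" using that x by (auto simp: c_def Q_def)
        assume "c n x \<in> Q"
        then obtain a where "c n a = c n x" "\<rho> n a \<in> S" by (auto simp: Q_def)
        then show "\<rho> n x \<in> S" using \<rho>_eq[of n a x] by simp
      qed
      have "\<rho> n -` S \<inter> A = (\<Union>P\<in>Q. {a. c n a = P}) \<inter> A"
        using Q by auto
      moreover have "(\<Union>P\<in>Q. {a. c n a = P}) \<in> sets borel"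
        using finB cell by (intro sets.finite_UN) (auto simp: Q_def)
      ultimately show "\<rho> n -` S \<inter> space (restrict_space borel A) \<in> sets (restrict_space borel A)"
        by (auto simp: space_restrict_space sets_restrict_space)
    qed
    show "\<rho> n (\<rho> k a) = \<rho> n a" if "n \<le> k" "a \<in> A" for n k a
    proof (rule \<rho>_eq)
      have "c n b = c k b \<inter> B n" for b using Bmono[OF that(1)] by (auto simp: c_def)
      then show "c n (\<rho> k a) = c n a" using \<rho>[OF that(2), of k] by simp
    qed
    show "\<exists>N. \<forall>n\<ge>N. \<forall>a\<in>A. dist (\<rho> n a) a < \<epsilon>" if "\<epsilon> > 0" for \<epsilon>
    proof -
      \<comment> \<open>The balls of radius \<open>1 / Suc m\<close> enter \<open>B n\<close> from
        \<open>n = Suc m\<close> on. Some such ball contains both \<open>a\<close> and its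
        representative, whence the radius below \<epsilon>/2.\<close>
      obtain m where m: "inverse (real (Suc m)) < \<epsilon> / 2" using reals_Archimedean[of "\<epsilon>/2"] \<open>\<epsilon> > 0\<close> by (meson half_gt_zero)
      have "dist (\<rho> n a) a < \<epsilon>" if n: "n \<ge> Suc m" and a: "a \<in> A" for n a
      proof -
        obtain x where x: "x \<in> D m" "a \<in> ball x (inverse (real (Suc m)))" using D(2) a by blast
        then have "ball x (inverse (real (Suc m))) \<in> c n a" using n by (auto simp: c_def B_def)
        then have "ball x (inverse (real (Suc m))) \<in> c n (\<rho> n a)" using \<rho>[OF a, of n] by simp
        then have "\<rho> n a \<in> ball x (inverse (real (Suc m)))" by (simp add: c_def)
        then have "dist x (\<rho> n a) < \<epsilon> / 2" "dist x a < \<epsilon> / 2" using x(2) m by simp_all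
        then show ?thesis by (rule dist_triangle_half_r)
      qed
      then show ?thesis by blast
    qed
  qed
qed

section \<open>Conditional probabilities over a nowhere equivalent sub-sigma-algebra\<close>

locale nowhere_equivalent_subalgebra = prob_space M for M :: "'t measure" +
  fixes F :: "'t measure"
  assumes subalg: "subalgebra M F"
    and nowhere_equiv: "nowhere_equivalent M F"
begin

lemma F_in_sets [intro]: "G \<in> sets F \<Longrightarrow> G \<in> sets M"
  using subalg by (auto simp: subalgebra_def)

lemma space_F [simp]: "space F = space M"
  using subalg by (auto simp: subalgebra_def)

lemma F_measurable [intro]: "q \<in> borel_measurable F \<Longrightarrow> q \<in> borel_measurable M"
  using subalg measurable_from_subalg by blast

sublocale sigma_finite_subalgebra M F
proof -
  interpret finite_measure_subalgebra M F
    using subalg by unfold_locales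
  show "sigma_finite_subalgebra M F" by unfold_locales
qed

definition cond_prob :: "'t set \<Rightarrow> 't \<Rightarrow> real" where
  "cond_prob E = real_cond_exp M F (indicator E)"

lemma cond_prob_F_measurable [measurable]: "cond_prob E \<in> borel_measurable F"
  by (simp add: cond_prob_def)

lemma integrable_cond_prob [intro]: "E \<in> sets M \<Longrightarrow> integrable M (cond_prob E)"
  unfolding cond_prob_def by (intro real_cond_exp_int) (simp add: emeasure_eq_measure)

lemma set_integral_cond_prob:
  assumes "E \<in> sets M" "G \<in> sets F"
  shows "(\<integral>x\<in>G. cond_prob E x \<partial>M) = prob (E \<inter> G)"
proof -
  have "(\<integral>x\<in>G. cond_prob E x \<partial>M) = (\<integral>x\<in>G. indicator E x \<partial>M)"
    unfolding cond_prob_def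
    by (rule real_cond_exp_intA[symmetric]) (use assms in \<open>simp_all add: emeasure_eq_measure\<close>)
  also have "\<dots> = (\<integral>x. indicator (E \<inter> G) x \<partial>M)"
    by (simp add: set_lebesgue_integral_def indicator_inter_arith mult.commute)
  also have "\<dots> = prob (E \<inter> G)" using assms by (simp add: F_in_sets sets.Int sets.sets_into_space Int_absorb1)
  finally show ?thesis .
qed

text \<open>The bound \<open>prob (E \<inter> G) \<le> c * prob G\<close> for all \<open>G\<close>
  in \<open>F\<close> expresses that the conditional probability of \<open>E\<close> is at most
  \<open>c\<close>. Take \<open>D \<subseteq> E\<close> that differs essentially from every trace of
  \<open>F\<close> on \<open>E\<close>. Where \<open>D\<close> has at most half of the conditional
  probability of \<open>E\<close> (the set \<open>H\<close>) keep \<open>D\<close>, elsewhere keep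
  \<open>E - D\<close>. If the result \<open>C\<close> were null, \<open>D\<close> would coincide
  almost surely with the trace on \<open>E\<close> of the complement of \<open>H\<close>.\<close>

lemma halving:
  assumes E: "E \<in> sets M" "prob E > 0" and c: "\<And>G. G \<in> sets F \<Longrightarrow> prob (E \<inter> G) \<le> c * prob G"
  obtains C where "C \<in> sets M" "C \<subseteq> E" "prob C > 0"
    "\<And>G. G \<in> sets F \<Longrightarrow> prob (C \<inter> G) \<le> c / 2 * prob G"
proof -
  obtain D where D: "D \<in> sets M" "D \<subseteq> E"
    and D': "\<And>G. G \<in> sets F \<Longrightarrow> prob ((D - (E \<inter> G)) \<union> ((E \<inter> G) - D)) > 0"
    using nowhere_equiv E unfolding nowhere_equivalent_def by metis
  define p where "p = cond_prob D"
  define r where "r = cond_prob E"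
  have [measurable]: "p \<in> borel_measurable F" "r \<in> borel_measurable F" by (simp_all add: p_def r_def)
  have int: "integrable M p" "integrable M r" using D E by (auto simp: p_def r_def)
  define H where "H = {x \<in> space F. p x \<le> r x / 2}"
  have H: "H \<in> sets F" unfolding H_def by measurable
  have HM: "H \<in> sets M" using H by auto
  define C where "C = (D \<inter> H) \<union> ((E - D) - H)"
  have C: "C \<in> sets M" using D E HM by (auto simp: C_def)
  have si: "set_integrable M G p" "set_integrable M G r" if "G \<in> sets M" for G
    using int that by (auto simp: set_integrable_def intro!: integrable_mult_indicator[where 'b=real, simplified real_scaleR_def])
  have "prob (C \<inter> G) \<le> c / 2 * prob G" if G: "G \<in> sets F" for G
  proof -
    have GH: "G \<inter> H \<in> sets F" "G - H \<in> sets F" using G H by auto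
    have GHM: "G \<inter> H \<in> sets M" "G - H \<in> sets M" using GH by auto
    have "C \<inter> G = (D \<inter> (G \<inter> H)) \<union> (E - D) \<inter> (G - H)" by (auto simp: C_def)
    then have "prob (C \<inter> G) = prob (D \<inter> (G \<inter> H)) + prob ((E - D) \<inter> (G - H))"
      using D E GHM by (simp add: finite_measure_Union sets.Int sets.Diff disjoint_iff)
    also have "prob ((E - D) \<inter> (G - H)) = prob (E \<inter> (G - H)) - prob (D \<inter> (G - H))"
    proof -
      have "(E - D) \<inter> (G - H) = E \<inter> (G - H) - D \<inter> (G - H)" by auto
      then show ?thesis using D E GHM by (auto intro!: finite_measure_Diff)
    qed
    also have "prob (D \<inter> (G \<inter> H)) + (prob (E \<inter> (G - H)) - prob (D \<inter> (G - H)))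
       = (\<integral>x\<in>G \<inter> H. p x \<partial>M) + ((\<integral>x\<in>G - H. r x \<partial>M) - (\<integral>x\<in>G - H. p x \<partial>M))"
      using D E GH by (simp add: set_integral_cond_prob p_def r_def)
    also have "\<dots> \<le> (\<integral>x\<in>G \<inter> H. r x / 2 \<partial>M) + (\<integral>x\<in>G - H. r x / 2 \<partial>M)"
    proof -
      have "(\<integral>x\<in>G \<inter> H. p x \<partial>M) \<le> (\<integral>x\<in>G \<inter> H. r x / 2 \<partial>M)"
        by (intro set_integral_mono si GHM set_integrable_divide) (auto simp: H_def)
      moreover have "(\<integral>x\<in>G - H. r x \<partial>M) - (\<integral>x\<in>G - H. p x \<partial>M) \<le> (\<integral>x\<in>G - H. r x / 2 \<partial>M)"
      proof (subst set_integral_diff(2)[symmetric])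
        show "(\<integral>x\<in>G - H. r x - p x \<partial>M) \<le> (\<integral>x\<in>G - H. r x / 2 \<partial>M)"
          using G sets.sets_into_space[of G F]
          by (intro set_integral_mono si GHM set_integrable_divide set_integral_diff(1)) (auto simp: H_def)
      qed (auto intro: si GHM)
      ultimately show ?thesis by simp
    qed
    also have "\<dots> = ((\<integral>x\<in>G \<inter> H. r x \<partial>M) + (\<integral>x\<in>G - H. r x \<partial>M)) / 2" by simp
    also have "\<dots> = (prob (E \<inter> (G \<inter> H)) + prob (E \<inter> (G - H))) / 2"
      using E GH by (simp add: set_integral_cond_prob r_def)
    also have "prob (E \<inter> (G \<inter> H)) + prob (E \<inter> (G - H)) = prob (E \<inter> G)"
    proof -
      have "E \<inter> G = (E \<inter> (G \<inter> H)) \<union> (E \<inter> (G - H))" by auto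
      then show ?thesis using E GHM by (simp add: finite_measure_Union[symmetric] sets.Int disjoint_iff)
    qed
    also have "\<dots> / 2 \<le> c / 2 * prob G" using c[OF G] by simp
    finally show ?thesis .
  qed
  moreover have "prob C > 0"
  proof (rule ccontr)
    assume "\<not> prob C > 0"
    then have "prob C = 0" by (simp add: zero_less_measure_iff)
    moreover have "space F - H \<in> sets F" using H by (rule sets.compl_sets)
    moreover have "(D - E \<inter> (space F - H)) \<union> (E \<inter> (space F - H) - D) = C"
      using D E sets.sets_into_space[of E M] by (auto simp: C_def)
    ultimately show False using D'[of "space F - H"] by simp
  qed
  moreover have "C \<subseteq> E" using D by (auto simp: C_def)
  ultimately show ?thesis using C that by blast
qed

text \<open>Halving is iterated from the trivial bound 1. The resulting pieces fit into arbitrarily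
  thin gaps between conditional probabilities.\<close>

lemma small_conditional_probability:
  assumes E: "E \<in> sets M" "prob E > 0"
  shows "\<exists>C\<in>sets M. C \<subseteq> E \<and> prob C > 0 \<and> (\<forall>G\<in>sets F. prob (C \<inter> G) \<le> (1/2)^m * prob G)"
proof (induction m)
  case 0
  show ?case using E F_in_sets by (intro bexI[of _ E]) (auto intro!: finite_measure_mono)
next
  case (Suc m)
  then obtain C where C: "C \<in> sets M" "C \<subseteq> E" "prob C > 0"
    "\<And>G. G \<in> sets F \<Longrightarrow> prob (C \<inter> G) \<le> (1/2)^m * prob G" by blast
  obtain C' where "C' \<in> sets M" "C' \<subseteq> C" "prob C' > 0"
    "\<And>G. G \<in> sets F \<Longrightarrow> prob (C' \<inter> G) \<le> (1/2)^m / 2 * prob G"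
    using halving[OF C(1,3,4)] by blast
  then show ?case using C(2) by (intro bexI[of _ C']) auto
qed

text \<open>A greedy exhaustion: the n-th step passes to a superset in the class whose probability
  is within \<open>(1/2)^n\<close> of the supremum \<open>v\<close> over all supersets. Anything
  containing the union competes at every step, hence cannot have larger probability.\<close>

lemma exists_maximal_set:
  assumes ne: "{} \<in> \<C>" and sub: "\<C> \<subseteq> sets M"
    and union: "\<And>S. incseq S \<Longrightarrow> range S \<subseteq> \<C> \<Longrightarrow> (\<Union>n. S n) \<in> \<C>"
  obtains C where "C \<in> \<C>" "\<And>C'. C' \<in> \<C> \<Longrightarrow> C \<subseteq> C' \<Longrightarrow> prob C' \<le> prob C"
proof -
  define v where "v C = (SUP C'\<in>{C'\<in>\<C>. C \<subseteq> C'}. prob C')" for C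
  have bdd: "bdd_above (prob ` X)" for X by (rule bdd_aboveI[of _ 1]) auto
  have step: "\<exists>C'. C' \<in> \<C> \<and> C \<subseteq> C' \<and> prob C' > v C - (1/2)^n" if "C \<in> \<C>" for C n
  proof -
    have ne: "{C' \<in> \<C>. C \<subseteq> C'} \<noteq> {}" using that by auto
    have "v C - (1/2)^n < v C" by simp
    then obtain C' where "C' \<in> {C' \<in> \<C>. C \<subseteq> C'}" "v C - (1/2)^n < prob C'"
      using less_cSUP_iff[OF ne bdd, of "v C - (1/2)^n"] by (auto simp: v_def[symmetric])
    then show ?thesis by blast
  qed
  have "\<exists>S. \<forall>n. S n \<in> \<C> \<and> S n \<subseteq> S (Suc n) \<and> prob (S (Suc n)) > v (S n) - (1/2)^n"
    using dependent_nat_choice[where P="\<lambda>n C. C \<in> \<C>" and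
        Q="\<lambda>n C C'. C \<subseteq> C' \<and> prob C' > v C - (1/2)^n"] step ne by metis
  then obtain S where S: "\<And>n. S n \<in> \<C>" "\<And>n. S n \<subseteq> S (Suc n)"
      "\<And>n. prob (S (Suc n)) > v (S n) - (1/2)^n" by blast
  let ?C = "\<Union>n. S n"
  have inc: "incseq S" using S(2) by (rule incseq_SucI)
  have C: "?C \<in> \<C>" using S inc by (intro union) auto
  moreover have "prob C' \<le> prob ?C" if C': "C' \<in> \<C>" "?C \<subseteq> C'" for C'
  proof -
    have le: "prob C' \<le> prob (S (Suc n)) + (1/2)^n" for n
    proof -
      have "prob C' \<le> v (S n)"
        unfolding v_def using C' bdd by (intro cSUP_upper) auto
      then show ?thesis using S(3)[of n] by simp
    qed
    have "(\<lambda>n. prob (S n)) \<longlonglongrightarrow> prob ?C"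
      using S(1) sub inc by (intro finite_Lim_measure_incseq) auto
    from LIMSEQ_Suc[OF this] have "(\<lambda>n. prob (S (Suc n)) + (1/2)^n) \<longlonglongrightarrow> prob ?C + 0"
      by (intro tendsto_add LIMSEQ_power_zero) auto
    then show ?thesis using le by (intro LIMSEQ_le_const) auto
  qed
  ultimately show ?thesis by (rule that)
qed

text \<open>A conditional Lyapunov theorem. A maximal \<open>C \<subseteq> E\<close> with conditional probability at most \<open>q\<close>
  attains \<open>q\<close>: otherwise the gap could be partly filled with a piece of \<open>E - C\<close> of small
  conditional probability.\<close>

lemma subset_with_conditional_probability:
  assumes E: "E \<in> sets M" and q: "q \<in> borel_measurable F" "integrable M q" "\<And>x. x \<in> space M \<Longrightarrow> q x \<ge> 0"
    and qE: "\<And>G. G \<in> sets F \<Longrightarrow> (\<integral>x\<in>G. q x \<partial>M) \<le> prob (E \<inter> G)"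
  obtains C where "C \<in> sets M" "C \<subseteq> E" "\<And>G. G \<in> sets F \<Longrightarrow> prob (C \<inter> G) = (\<integral>x\<in>G. q x \<partial>M)"
proof -
  define \<C> where "\<C> = {C \<in> sets M. C \<subseteq> E \<and> (\<forall>G\<in>sets F. prob (C \<inter> G) \<le> (\<integral>x\<in>G. q x \<partial>M))}"
  have q0: "(\<integral>x\<in>G. q x \<partial>M) \<ge> 0" if "G \<in> sets F" for G
    unfolding set_lebesgue_integral_def using q(3) by (intro integral_nonneg_AE) auto
  obtain C where C: "C \<in> \<C>" and max: "\<And>C'. C' \<in> \<C> \<Longrightarrow> C \<subseteq> C' \<Longrightarrow> prob C' \<le> prob C"
  proof (rule exists_maximal_set[of \<C>])
    fix S :: "nat \<Rightarrow> 't set" assume S: "incseq S" "range S \<subseteq> \<C>"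
    show "(\<Union>n. S n) \<in> \<C>"
      unfolding \<C>_def
    proof (safe)
      fix G assume G: "G \<in> sets F"
      have "(\<lambda>n. prob (S n \<inter> G)) \<longlonglongrightarrow> prob (\<Union>n. S n \<inter> G)"
        using S F_in_sets[OF G]
        by (intro finite_Lim_measure_incseq) (auto simp: \<C>_def incseq_def image_subset_iff)
      then show "prob ((\<Union>n. S n) \<inter> G) \<le> (\<integral>x\<in>G. q x \<partial>M)"
        using S G by (intro LIMSEQ_le_const2[of "\<lambda>n. prob (S n \<inter> G)"]) (auto simp: \<C>_def)
    qed (use S in \<open>auto simp: \<C>_def\<close>)
  qed (auto simp: \<C>_def q0)
  have CM: "C \<in> sets M" "C \<subseteq> E" and Cq: "\<And>G. G \<in> sets F \<Longrightarrow> prob (C \<inter> G) \<le> (\<integral>x\<in>G. q x \<partial>M)"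
    using C by (auto simp: \<C>_def)
  define p where "p = cond_prob C"
  have [measurable]: "p \<in> borel_measurable F" "q \<in> borel_measurable F" using q by (simp_all add: p_def)
  have pint: "integrable M p" using CM by (auto simp: p_def)
  have si: "set_integrable M G p" "set_integrable M G q" if "G \<in> sets F" for G
    using pint q(2) F_in_sets[OF that] by (auto simp: set_integrable_def intro!: integrable_mult_indicator[where 'b=real, simplified real_scaleR_def])
  \<comment> \<open>On \<open>H m\<close> the conditional probability \<open>p\<close> of the
    maximal set misses the target \<open>q\<close> by at least \<open>(1/2)^m\<close>. Each
    \<open>H m\<close> will turn out to be null.\<close>
  define H where "H m = {x \<in> space F. p x + (1/2)^m \<le> q x}" for m :: nat
  have HF: "H m \<in> sets F" for m unfolding H_def by measurable
  have null: "prob (H m) = 0" for m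
  proof (rule ccontr)
    assume "prob (H m) \<noteq> 0"
    then have Hpos: "prob (H m) > 0" by (simp add: zero_less_measure_iff)
    let ?E = "(E - C) \<inter> H m"
    \<comment> \<open>Since \<open>q\<close> is dominated by the conditional probability of
      \<open>E\<close>, the gap on \<open>H m\<close> forces \<open>E - C\<close> to have positive
      probability there.\<close>
    have "(1/2)^m * prob (H m) = (\<integral>x\<in>H m. (1/2)^m \<partial>M)"
      using F_in_sets[OF HF] by (simp add: set_lebesgue_integral_def mult.commute)
    also have "\<dots> \<le> (\<integral>x\<in>H m. q x - p x \<partial>M)"
    proof (rule set_integral_mono)
      show "set_integrable M (H m) (\<lambda>x. (1/2)^m)"
        using F_in_sets[OF HF] by (simp add: set_integrable_def emeasure_eq_measure)
      show "set_integrable M (H m) (\<lambda>x. q x - p x)"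
        by (intro set_integral_diff(1) si HF)
    qed (simp add: H_def)
    also have "\<dots> = (\<integral>x\<in>H m. q x \<partial>M) - (\<integral>x\<in>H m. p x \<partial>M)"
      using HF si by (intro set_integral_diff) auto
    also have "\<dots> \<le> prob (E \<inter> H m) - prob (C \<inter> H m)"
      using qE[OF HF] set_integral_cond_prob[OF CM(1) HF] by (simp add: p_def)
    also have "\<dots> = prob (E \<inter> H m - C \<inter> H m)"
      using E CM HF by (intro finite_measure_Diff[symmetric]) auto
    also have "E \<inter> H m - C \<inter> H m = ?E" by auto
    finally have Epos: "prob ?E > 0" using Hpos by (smt (verit) mult_pos_pos zero_less_power zero_less_divide_1_iff)
    have EM: "?E \<in> sets M" using E CM HF by auto
    obtain D where D: "D \<in> sets M" "D \<subseteq> ?E" "prob D > 0"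
      "\<And>G. G \<in> sets F \<Longrightarrow> prob (D \<inter> G) \<le> (1/2)^m * prob G"
      using small_conditional_probability[OF EM Epos, of m] by blast
    \<comment> \<open>\<open>D\<close> lives inside \<open>H m\<close> and adds at most
      \<open>(1/2)^m\<close> to the conditional probability, exactly the room available there.
      Splitting \<open>G\<close> along \<open>H m\<close> shows that the enlarged set is still
      admissible, against maximality.\<close>
    have "C \<union> D \<in> \<C>"
      unfolding \<C>_def
    proof (safe)
      fix G assume G: "G \<in> sets F"
      have GH: "G - H m \<in> sets F" "G \<inter> H m \<in> sets F" using G HF by auto
      note GHM = F_in_sets[OF GH(1)] F_in_sets[OF GH(2)]
      have "(C \<union> D) \<inter> G = (C \<inter> (G - H m)) \<union> ((C \<inter> (G \<inter> H m)) \<union> (D \<inter> (G \<inter> H m)))"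
        using D(2) by auto
      also have "prob \<dots> = prob (C \<inter> (G - H m)) + prob ((C \<inter> (G \<inter> H m)) \<union> (D \<inter> (G \<inter> H m)))"
        using CM D GHM by (intro finite_measure_Union) (auto intro!: sets.Int sets.Un)
      also have "prob ((C \<inter> (G \<inter> H m)) \<union> (D \<inter> (G \<inter> H m))) = prob (C \<inter> (G \<inter> H m)) + prob (D \<inter> (G \<inter> H m))"
        using CM D GHM by (intro finite_measure_Union) (auto intro!: sets.Int)
      also have "prob (C \<inter> (G - H m)) \<le> (\<integral>x\<in>G - H m. q x \<partial>M)" by (rule Cq[OF GH(1)])
      also have "prob (C \<inter> (G \<inter> H m)) = (\<integral>x\<in>G \<inter> H m. p x \<partial>M)"
        using set_integral_cond_prob[OF CM(1) GH(2)] by (simp add: p_def)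
      also have "prob (D \<inter> (G \<inter> H m)) \<le> (\<integral>x\<in>G \<inter> H m. (1/2)^m \<partial>M)"
        using D(4)[OF GH(2)] GHM by (simp add: set_lebesgue_integral_def mult.commute)
      finally have "prob ((C \<union> D) \<inter> G) \<le> (\<integral>x\<in>G - H m. q x \<partial>M) +
          ((\<integral>x\<in>G \<inter> H m. p x \<partial>M) + (\<integral>x\<in>G \<inter> H m. (1/2)^m \<partial>M))" by simp
      also have "(\<integral>x\<in>G \<inter> H m. p x \<partial>M) + (\<integral>x\<in>G \<inter> H m. (1/2)^m \<partial>M) = (\<integral>x\<in>G \<inter> H m. p x + (1/2)^m \<partial>M)"
        using GH GHM by (intro set_integral_add(2)[symmetric] si) (auto simp: set_integrable_def emeasure_eq_measure)
      also have "\<dots> \<le> (\<integral>x\<in>G \<inter> H m. q x \<partial>M)"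
        using GH GHM
        by (intro set_integral_mono set_integral_add(1) si) (auto simp: H_def set_integrable_def emeasure_eq_measure)
      also have "(\<integral>x\<in>G - H m. q x \<partial>M) + (\<integral>x\<in>G \<inter> H m. q x \<partial>M) = (\<integral>x\<in>(G - H m) \<union> (G \<inter> H m). q x \<partial>M)"
        using GH by (intro set_integral_Un[symmetric] si) auto
      also have "(G - H m) \<union> (G \<inter> H m) = G" by auto
      finally show "prob ((C \<union> D) \<inter> G) \<le> (\<integral>x\<in>G. q x \<partial>M)" by simp
    qed (use D CM in auto)
    then have "prob (C \<union> D) \<le> prob C" by (rule max) simp
    moreover have "prob (C \<union> D) = prob C + prob D"
      using D CM by (intro finite_measure_Union) auto
    ultimately show False using D(3) by simp
  qed
  have "AE x in M. q x \<le> p x"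
  proof -
    have "AE x in M. \<forall>m. x \<notin> H m"
      unfolding AE_all_countable
    proof
      fix m show "AE x in M. x \<notin> H m"
        using null[of m] HF[of m] by (intro AE_not_in) (auto simp: null_sets_def emeasure_eq_measure)
    qed
    with AE_space show ?thesis
    proof eventually_elim
      case (elim x)
      show ?case
      proof (rule ccontr)
        assume "\<not> q x \<le> p x"
        then obtain m where "(1/2::real)^m < q x - p x" using real_arch_pow_inv[of "q x - p x" "1/2"] by auto
        then have "p x + (1/2)^m \<le> q x" by simp
        then have "x \<in> H m" using elim(1) by (simp add: H_def)
        with elim show False by blast
      qed
    qed
  qed
  have "prob (C \<inter> G) = (\<integral>x\<in>G. q x \<partial>M)" if G: "G \<in> sets F" for G
  proof (rule antisym[OF Cq[OF G]])
    have "(\<integral>x\<in>G. q x \<partial>M) \<le> (\<integral>x\<in>G. p x \<partial>M)"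
      using \<open>AE x in M. q x \<le> p x\<close> by (intro set_integral_mono_AE si G) auto
    then show "(\<integral>x\<in>G. q x \<partial>M) \<le> prob (C \<inter> G)"
      using set_integral_cond_prob[OF CM(1) G] by (simp add: p_def)
  qed
  then show ?thesis using CM that by blast
qed

end

section \<open>Countable generators, and purification along partitions and trees\<close>

text \<open>Finite intersections of the generators, the empty one being the whole space.
  Countability feeds the diagonal extraction; stability under intersections and membership of the
  space feed the Dynkin induction.\<close>

lemma countable_Int_stable_generator:
  assumes "countably_generated F"
  obtains \<G> where "countable \<G>" "Int_stable \<G>" "\<G> \<subseteq> Pow (space F)" "space F \<in> \<G>"
    "sets F = sigma_sets (space F) \<G>"
proof -
  obtain G where G: "countable G" "G \<subseteq> Pow (space F)" "sets F = sigma_sets (space F) G"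
    using assms by (auto simp: countably_generated_def)
  define \<G> where "\<G> = (\<lambda>S. space F \<inter> \<Inter>S) ` {S. finite S \<and> S \<subseteq> G}"
  have mem: "A \<in> \<G> \<longleftrightarrow> (\<exists>S. finite S \<and> S \<subseteq> G \<and> A = space F \<inter> \<Inter>S)" for A by (auto simp: \<G>_def)
  have GF: "\<G> \<subseteq> sets F"
  proof
    fix A assume "A \<in> \<G>"
    then obtain S where S: "finite S" "S \<subseteq> G" "A = space F \<inter> \<Inter>S" using mem by auto
    have "S \<subseteq> sets F" using S G by auto
    then show "A \<in> sets F"
      using S(1) sets.finite_INT[of S "\<lambda>x. x" F] by (cases "S = {}") (auto simp: S(3))
  qed
  show ?thesis
  proof
    show "countable \<G>" using countable_Collect_finite_subset[OF G(1)] by (simp add: \<G>_def)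
    show "Int_stable \<G>"
    proof (rule Int_stableI)
      fix A B assume "A \<in> \<G>" "B \<in> \<G>"
      then obtain S S' where "finite S" "S \<subseteq> G" "A = space F \<inter> \<Inter>S" "finite S'" "S' \<subseteq> G" "B = space F \<inter> \<Inter>S'"
        using mem by auto
      then have "finite (S \<union> S')" "S \<union> S' \<subseteq> G" "A \<inter> B = space F \<inter> \<Inter>(S \<union> S')" by auto
      then show "A \<inter> B \<in> \<G>" unfolding mem by (intro exI[of _ "S \<union> S'"]) simp
    qed
    show "\<G> \<subseteq> Pow (space F)" by (auto simp: mem)
    show "space F \<in> \<G>" unfolding mem by (rule exI[of _ "{}"]) simp
    show "sets F = sigma_sets (space F) \<G>"
    proof
      have "G \<subseteq> \<G>"
      proof
        fix A assume "A \<in> G"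
        then have "finite {A} \<and> {A} \<subseteq> G \<and> A = space F \<inter> \<Inter>{A}" using G by auto
        then show "A \<in> \<G>" using mem by blast
      qed
      then show "sets F \<subseteq> sigma_sets (space F) \<G>" unfolding G(3) by (rule sigma_sets_mono')
      show "sigma_sets (space F) \<G> \<subseteq> sets F" using GF by (rule sets.sigma_sets_subset)
    qed
  qed
qed

context nowhere_equivalent_subalgebra
begin

text \<open>Purification: the weights \<open>q s\<close> describe a mixed strategy on
  \<open>E\<close>, and \<open>Y\<close> is a pure one with the same conditional law. By induction
  on \<open>S\<close>, the conditional Lyapunov theorem carves the piece for one \<open>s\<close>
  out of \<open>E\<close>; the remaining weights then add up to the conditional probability of the
  rest.\<close>

lemma finite_partition_with_conditional_probabilities:
  assumes "finite S" "S \<noteq> {}" "E \<in> sets M"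
    and "\<And>s. s \<in> S \<Longrightarrow> q s \<in> borel_measurable F \<and> integrable M (q s) \<and> (\<forall>x\<in>space M. q s x \<ge> 0)"
    and "\<And>G. G \<in> sets F \<Longrightarrow> (\<Sum>s\<in>S. \<integral>x\<in>G. q s x \<partial>M) = prob (E \<inter> G)"
  shows "\<exists>Y. (\<forall>x. Y x \<in> S) \<and> (\<forall>s\<in>S. E \<inter> Y -` {s} \<in> sets M \<and>
    (\<forall>G\<in>sets F. prob (E \<inter> Y -` {s} \<inter> G) = (\<integral>x\<in>G. q s x \<partial>M)))"
  using assms
proof (induction S arbitrary: E rule: finite_ne_induct)
  case (singleton s)
  then show ?case by (intro exI[of _ "\<lambda>_. s"]) (simp add: Int_absorb2 vimage_const)
next
  case (insert s S)
  have q: "q s \<in> borel_measurable F" "integrable M (q s)" "\<And>x. x \<in> space M \<Longrightarrow> q s x \<ge> 0"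
    using insert.prems(2)[of s] by auto
  have "(\<integral>x\<in>G. q s x \<partial>M) \<le> prob (E \<inter> G)" if "G \<in> sets F" for G
  proof -
    have "0 \<le> (\<Sum>s\<in>S. \<integral>x\<in>G. q s x \<partial>M)"
      unfolding set_lebesgue_integral_def
      using insert.prems(2) by (intro sum_nonneg integral_nonneg_AE) auto
    then show ?thesis using insert.prems(3)[OF that] insert.hyps by simp
  qed
  then obtain C where C: "C \<in> sets M" "C \<subseteq> E" "\<And>G. G \<in> sets F \<Longrightarrow> prob (C \<inter> G) = (\<integral>x\<in>G. q s x \<partial>M)"
    using subset_with_conditional_probability[OF insert.prems(1) q] by blast
  have "(\<Sum>s\<in>S. \<integral>x\<in>G. q s x \<partial>M) = prob ((E - C) \<inter> G)" if G: "G \<in> sets F" for G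
  proof -
    have "prob ((E - C) \<inter> G) = prob (E \<inter> G - C \<inter> G)" by (rule arg_cong[where f=prob]) auto
    also have "\<dots> = prob (E \<inter> G) - prob (C \<inter> G)"
      using C insert.prems(1) F_in_sets[OF G] by (intro finite_measure_Diff) auto
    finally show ?thesis using insert.prems(3)[OF G] C(3)[OF G] insert.hyps by simp
  qed
  then have "\<exists>Y. (\<forall>x. Y x \<in> S) \<and> (\<forall>t\<in>S. (E - C) \<inter> Y -` {t} \<in> sets M \<and>
    (\<forall>G\<in>sets F. prob ((E - C) \<inter> Y -` {t} \<inter> G) = (\<integral>x\<in>G. q t x \<partial>M)))"
    using insert.prems C by (intro insert.IH) auto
  then obtain Y where Y: "\<And>x. Y x \<in> S" "\<And>t. t \<in> S \<Longrightarrow> (E - C) \<inter> Y -` {t} \<in> sets M"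
    "\<And>t G. t \<in> S \<Longrightarrow> G \<in> sets F \<Longrightarrow> prob ((E - C) \<inter> Y -` {t} \<inter> G) = (\<integral>x\<in>G. q t x \<partial>M)"
    by blast
  define Y' where "Y' x = (if x \<in> C then s else Y x)" for x
  have "E \<inter> Y' -` {t} = (if t = s then C else (E - C) \<inter> Y -` {t})" if "t \<in> insert s S" for t
  proof (cases "t = s")
    case True
    have "Y x \<noteq> s" for x using Y(1) insert.hyps by metis
    then have "Y' x = s \<longleftrightarrow> x \<in> C" for x by (simp add: Y'_def)
    then show ?thesis using True C(2) by auto
  next
    case False
    then show ?thesis by (auto simp: Y'_def)
  qed
  moreover have "Y' x \<in> insert s S" for x using Y(1) by (simp add: Y'_def)
  ultimately show ?case using C Y by (intro exI[of _ Y']) auto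
qed

text \<open>\<open>X n\<close> is the n-th level of a tree and \<open>\<pi> n\<close> its parent
  map. Each cell of level \<open>n\<close> is partitioned among its children, whose weights add up
  to that of the parent by \<open>qS\<close>. The realizations are therefore coherent at every
  point, not merely almost everywhere.\<close>

lemma tree_with_conditional_probabilities:
  assumes X: "\<And>n. finite (X n)" "X 0 \<noteq> {}"
    and \<pi>: "\<And>n s. s \<in> X n \<Longrightarrow> \<exists>s'\<in>X (Suc n). \<pi> n s' = s"
    and \<pi>X: "\<And>n s. s \<in> X (Suc n) \<Longrightarrow> \<pi> n s \<in> X n"
    and q: "\<And>n s. s \<in> X n \<Longrightarrow> q n s \<in> borel_measurable F \<and> integrable M (q n s) \<and> (\<forall>x\<in>space M. q n s x \<ge> 0)"
    and q0: "\<And>G. G \<in> sets F \<Longrightarrow> (\<Sum>s\<in>X 0. \<integral>x\<in>G. q 0 s x \<partial>M) = prob G"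
    and qS: "\<And>n s G. s \<in> X n \<Longrightarrow> G \<in> sets F \<Longrightarrow>
      (\<Sum>s'\<in>{s'\<in>X (Suc n). \<pi> n s' = s}. \<integral>x\<in>G. q (Suc n) s' x \<partial>M) = (\<integral>x\<in>G. q n s x \<partial>M)"
  obtains Z where "\<And>n x. Z n x \<in> X n" "\<And>n x. \<pi> n (Z (Suc n) x) = Z n x"
    "\<And>n s. s \<in> X n \<Longrightarrow> space M \<inter> Z n -` {s} \<in> sets M"
    "\<And>n s G. s \<in> X n \<Longrightarrow> G \<in> sets F \<Longrightarrow> prob (space M \<inter> Z n -` {s} \<inter> G) = (\<integral>x\<in>G. q n s x \<partial>M)"
proof -
  define R where "R n Y \<longleftrightarrow> (\<forall>x. Y x \<in> X n) \<and> (\<forall>s\<in>X n. space M \<inter> Y -` {s} \<in> sets M \<and>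
    (\<forall>G\<in>sets F. prob (space M \<inter> Y -` {s} \<inter> G) = (\<integral>x\<in>G. q n s x \<partial>M)))" for n Y
  have "\<exists>Z. \<forall>n. R n (Z n) \<and> (\<forall>x. \<pi> n (Z (Suc n) x) = Z n x)"
  proof (rule dependent_nat_choice)
    have "\<And>G. G \<in> sets F \<Longrightarrow> (\<Sum>s\<in>X 0. \<integral>x\<in>G. q 0 s x \<partial>M) = prob (space M \<inter> G)"
      using q0 F_in_sets sets.sets_into_space by (metis Int_absorb1)
    then show "\<exists>Y. R 0 Y"
      using finite_partition_with_conditional_probabilities[OF X(1)[of 0] X(2) sets.top q[of _ 0]] by (auto simp: R_def)
  next
    fix Y n assume Y: "R n Y"
    define P where "P s W \<longleftrightarrow> (\<forall>x. W x \<in> {s'\<in>X (Suc n). \<pi> n s' = s}) \<and> (\<forall>s'\<in>{s'\<in>X (Suc n). \<pi> n s' = s}.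
        (space M \<inter> Y -` {s}) \<inter> W -` {s'} \<in> sets M \<and>
        (\<forall>G\<in>sets F. prob ((space M \<inter> Y -` {s}) \<inter> W -` {s'} \<inter> G) = (\<integral>x\<in>G. q (Suc n) s' x \<partial>M)))" for s W
    have "\<exists>W. P s W" if s: "s \<in> X n" for s
      unfolding P_def using s Y qS[OF s] \<pi>[OF s] X(1) q
      by (intro finite_partition_with_conditional_probabilities) (auto simp: R_def)
    then obtain W where W0: "\<And>s. s \<in> X n \<Longrightarrow> P s (W s)" by metis
    have W: "\<And>s x. s \<in> X n \<Longrightarrow> W s x \<in> X (Suc n) \<and> \<pi> n (W s x) = s"
      "\<And>s s'. s \<in> X n \<Longrightarrow> s' \<in> X (Suc n) \<Longrightarrow> \<pi> n s' = s \<Longrightarrow> (space M \<inter> Y -` {s}) \<inter> W s -` {s'} \<in> sets M"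
      "\<And>s s' G. s \<in> X n \<Longrightarrow> s' \<in> X (Suc n) \<Longrightarrow> \<pi> n s' = s \<Longrightarrow> G \<in> sets F \<Longrightarrow>
        prob ((space M \<inter> Y -` {s}) \<inter> W s -` {s'} \<inter> G) = (\<integral>x\<in>G. q (Suc n) s' x \<partial>M)"
      using W0 by (simp_all add: P_def)
    have YX: "Y x \<in> X n" for x using Y by (simp add: R_def)
    \<comment> \<open>\<open>W s\<close> is a partition of the cell labelled \<open>s\<close>; each
      point uses the partition that belongs to its own cell.\<close>
    define Y' where "Y' x = W (Y x) x" for x
    have Y': "Y' x \<in> X (Suc n) \<and> \<pi> n (Y' x) = Y x" for x using W(1)[OF YX] by (simp add: Y'_def)
    have eq: "space M \<inter> Y' -` {s'} = (if \<pi> n s' \<in> X n then (space M \<inter> Y -` {\<pi> n s'}) \<inter> W (\<pi> n s') -` {s'} else {})" for s'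
      using Y' YX by (auto simp: Y'_def split: if_splits)
    have "R (Suc n) Y'"
      unfolding R_def
    proof (intro conjI ballI allI)
      fix s' assume s': "s' \<in> X (Suc n)"
      show "space M \<inter> Y' -` {s'} \<in> sets M" using eq W(2)[OF \<pi>X[OF s'] s' refl] by simp
      fix G assume G: "G \<in> sets F"
      show "prob (space M \<inter> Y' -` {s'} \<inter> G) = (\<integral>x\<in>G. q (Suc n) s' x \<partial>M)"
        using eq W(3)[OF \<pi>X[OF s'] s' refl G] \<pi>X[OF s'] by simp
    qed (use Y' in auto)
    then show "\<exists>Y'. R (Suc n) Y' \<and> (\<forall>x. \<pi> n (Y' x) = Y x)" using Y' by blast
  qed
  then obtain Z where "\<And>n. R n (Z n)" "\<And>n x. \<pi> n (Z (Suc n) x) = Z n x" by blast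
  then show ?thesis by (intro that[of Z]) (simp_all add: R_def)
qed

section \<open>Limits of conditional laws\<close>

text \<open>The summable majorant \<open>prob (G j)\<close> does not depend on \<open>k\<close>, so
  Tannery's theorem exchanges limit and sum. This yields both the union step of the Dynkin induction
  and the countable additivity of the limit set function.\<close>

lemma prob_Int_UN_tendsto:
  assumes E: "\<And>k. E k \<in> sets M" and G: "\<And>j. G j \<in> sets M" "disjoint_family G"
    and L: "\<And>j. (\<lambda>k. prob (E k \<inter> G j)) \<longlonglongrightarrow> L j"
  shows "summable L" "(\<lambda>k. prob (E k \<inter> (\<Union>j. G j))) \<longlonglongrightarrow> (\<Sum>j. L j)"
proof -
  have "(\<lambda>j. prob (G j)) sums prob (\<Union>j. G j)"
    using G by (intro finite_measure_UNION) auto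
  then have sm: "summable (\<lambda>j. prob (G j))" by (rule sums_summable)
  have "(\<lambda>j. prob (E k \<inter> G j)) sums prob (\<Union>j. E k \<inter> G j)" for k
    using G E by (intro finite_measure_UNION) (auto simp: disjoint_family_on_def)
  then have eq: "(\<Sum>j. prob (E k \<inter> G j)) = prob (E k \<inter> (\<Union>j. G j))" for k
    by (simp add: sums_iff)
  have "eventually (\<lambda>(j, k). norm (prob (E k \<inter> G j)) \<le> prob (G j)) (at_top \<times>\<^sub>F sequentially)"
    using G by (intro always_eventually) (auto intro!: finite_measure_mono)
  from tannerys_theorem[OF L this sm]
  show "summable L" "(\<lambda>k. prob (E k \<inter> (\<Union>j. G j))) \<longlonglongrightarrow> (\<Sum>j. L j)"
    by (auto simp: eq intro: summable_norm_cancel)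
qed

text \<open>Convergence on a countable generator spreads to all of \<open>F\<close> by Dynkin
  induction; hence one diagonal subsequence handles the possibly uncountable
  \<open>F\<close>.\<close>

lemma convergent_prob_Int:
  assumes E: "\<And>k. E k \<in> sets M"
    and \<G>: "Int_stable \<G>" "\<G> \<subseteq> Pow (space M)" "space M \<in> \<G>" "sets F = sigma_sets (space M) \<G>"
    and conv: "\<And>G. G \<in> \<G> \<Longrightarrow> convergent (\<lambda>k. prob (E k \<inter> G))" and G: "G \<in> sets F"
  shows "convergent (\<lambda>k. prob (E k \<inter> G))"
proof -
  have "G \<in> sigma_sets (space M) \<G>" using G \<G> by simp
  from \<G>(1,2) this show ?thesis
  proof (induction rule: sigma_sets_induct_disjoint)
    case (basic A) then show ?case by (rule conv)
  next
    case empty then show ?case by (simp add: convergent_const)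
  next
    case (compl A)
    then have A: "A \<in> sets M" using \<G>(4) F_in_sets by blast
    have "E k \<inter> (space M - A) = E k \<inter> space M - E k \<inter> A" for k by auto
    moreover have "prob (E k \<inter> space M - E k \<inter> A) = prob (E k \<inter> space M) - prob (E k \<inter> A)" for k
      using E[of k] A sets.sets_into_space[of A M] by (intro finite_measure_Diff) auto
    ultimately show ?case using convergent_diff[OF conv[OF \<G>(3)] compl.IH] by simp
  next
    case (union A)
    then have A: "A j \<in> sets M" for j using \<G>(4) F_in_sets by blast
    have "\<And>j. (\<lambda>k. prob (E k \<inter> A j)) \<longlonglongrightarrow> lim (\<lambda>k. prob (E k \<inter> A j))"
      using union.IH by (simp add: convergent_LIMSEQ_iff)
    from prob_Int_UN_tendsto(2)[OF E A union.hyps(1) this] show ?case by (auto simp: convergent_def)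
  qed
qed

text \<open>The limit \<open>\<nu>\<close> is a measure on \<open>F\<close> dominated by
  \<open>prob\<close>, so it has a Radon-Nikodym density. The theorem is applied to the restriction
  \<open>M'\<close> of \<open>M\<close> to \<open>F\<close>, which makes the density
  \<open>F\<close>-measurable.\<close>

lemma limit_density:
  assumes E: "\<And>k. E k \<in> sets M"
    and conv: "\<And>G. G \<in> sets F \<Longrightarrow> (\<lambda>k. prob (E k \<inter> G)) \<longlonglongrightarrow> \<nu> G"
  obtains q where "q \<in> borel_measurable F" "integrable M q" "\<And>x. q x \<ge> 0"
    "\<And>G. G \<in> sets F \<Longrightarrow> (\<integral>x\<in>G. q x \<partial>M) = \<nu> G"
proof -
  define M' where "M' = restr_to_subalg M F"
  have M': "sets M' = sets F" "space M' = space M" "\<And>A. A \<in> sets F \<Longrightarrow> emeasure M' A = emeasure M A"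
    using subalg by (simp_all add: M'_def sets_restr_to_subalg space_restr_to_subalg emeasure_restr_to_subalg)
  interpret M': prob_space M'
    unfolding M'_def using prob_space_restr_to_subalg[OF subalg] prob_space_axioms by simp
  have \<nu>0: "\<nu> G \<ge> 0" if "G \<in> sets F" for G
    by (rule LIMSEQ_le_const[OF conv[OF that]]) auto
  have \<nu>1: "\<nu> G \<le> prob G" if "G \<in> sets F" for G
    by (rule LIMSEQ_le_const2[OF conv[OF that]]) (use F_in_sets[OF that] in \<open>auto intro!: finite_measure_mono\<close>)
  define N where "N = measure_of (space M) (sets F) (\<lambda>G. ennreal (\<nu> G))"
  have sa: "sigma_algebra (space M) (sets F)" using sets.sigma_algebra_axioms[of F] by simp
  have sN: "sets N = sets F" "space N = space M"
    unfolding N_def using sa by (simp_all add: sigma_algebra.sets_measure_of_eq sigma_algebra.space_measure_of_eq)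
  have N: "emeasure N G = ennreal (\<nu> G)" if G: "G \<in> sets F" for G
    unfolding N_def
  proof (rule emeasure_measure_of_sigma[OF sa _ _ G])
    have "\<nu> {} = 0" using \<nu>0[of "{}"] \<nu>1[of "{}"] by simp
    then show "positive (sets F) (\<lambda>G. ennreal (\<nu> G))" by (simp add: positive_def)
    show "countably_additive (sets F) (\<lambda>G. ennreal (\<nu> G))"
    proof (rule countably_additiveI)
      fix A :: "nat \<Rightarrow> 't set" assume A: "range A \<subseteq> sets F" "disjoint_family A" "\<Union>(range A) \<in> sets F"
      have AF: "A j \<in> sets F" for j using A by auto
      note t = prob_Int_UN_tendsto[OF E F_in_sets[OF AF] A(2) conv[OF AF]]
      have "\<nu> (\<Union>j. A j) = (\<Sum>j. \<nu> (A j))"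
        by (rule LIMSEQ_unique[OF conv t(2)]) (use A in auto)
      then show "(\<Sum>j. ennreal (\<nu> (A j))) = ennreal (\<nu> (\<Union>(range A)))"
        using t(1) \<nu>0[OF AF] by (simp add: suminf_ennreal2)
    qed
  qed
  have "finite_measure N"
    by (rule finite_measureI) (use N[OF sets.top] in \<open>simp add: sN\<close>)
  moreover have "absolutely_continuous M' N"
    unfolding absolutely_continuous_def
  proof
    fix A assume "A \<in> null_sets M'"
    then have A: "A \<in> sets F" "prob A = 0" using M' by (auto simp: null_sets_def measure_def)
    then have "\<nu> A = 0" using \<nu>0[of A] \<nu>1[of A] by simp
    then show "A \<in> null_sets N" using A N by (simp add: null_sets_def sN)
  qed
  ultimately obtain f where f: "f \<in> borel_measurable M'" "density M' f = N"
    using M'.Radon_Nikodym_finite_measure[of N] sN M' by auto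
  have fF [measurable]: "f \<in> borel_measurable F" using f(1) measurable_cong_sets[OF M'(1) refl] by blast
  have fN: "(\<integral>\<^sup>+x. f x * indicator G x \<partial>M) = ennreal (\<nu> G)" if G [measurable]: "G \<in> sets F" for G
  proof -
    have "(\<integral>\<^sup>+x. f x * indicator G x \<partial>M) = (\<integral>\<^sup>+x. f x * indicator G x \<partial>M')"
      unfolding M'_def by (rule nn_integral_subalgebra2[OF subalg, symmetric])
        (use fF G in \<open>auto intro!: borel_measurable_times_ennreal borel_measurable_indicator\<close>)
    also have "\<dots> = emeasure (density M' f) G" using f(1) G M' by (simp add: emeasure_density)
    finally show ?thesis using N[OF G] f(2) by simp
  qed
  have fM [measurable]: "f \<in> borel_measurable M" using subalg fF measurable_from_subalg by blast
  have tot: "(\<integral>\<^sup>+x. f x \<partial>M) = ennreal (\<nu> (space M))"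
  proof -
    have "(\<integral>\<^sup>+x. f x \<partial>M) = (\<integral>\<^sup>+x. f x * indicator (space M) x \<partial>M)" by (intro nn_integral_cong) simp
    then show ?thesis using fN[OF sets.top] by simp
  qed
  have fin: "AE x in M. f x \<noteq> \<infinity>"
    by (rule nn_integral_PInf_AE) (simp_all add: tot)
  \<comment> \<open>The density may be infinite on a null set; \<open>enn2real\<close> turns that
    value into 0.\<close>
  define q where "q x = enn2real (f x)" for x
  have qf: "AE x in M. ennreal (q x) = f x" using fin by eventually_elim (simp add: q_def less_top)
  have qF [measurable]: "q \<in> borel_measurable F" unfolding q_def by measurable
  have qM [measurable]: "q \<in> borel_measurable M" using qF by auto
  have qN: "(\<integral>\<^sup>+x. ennreal (q x * indicator G x) \<partial>M) = ennreal (\<nu> G)" if G: "G \<in> sets F" for G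
  proof -
    have "(\<integral>\<^sup>+x. ennreal (q x * indicator G x) \<partial>M) = (\<integral>\<^sup>+x. f x * indicator G x \<partial>M)"
      using qf by (intro nn_integral_cong_AE) (auto split: split_indicator elim!: eventually_mono)
    then show ?thesis using fN[OF G] by simp
  qed
  have "integrable M q"
  proof (rule integrableI_nonneg)
    have "(\<integral>\<^sup>+x. ennreal (q x) \<partial>M) = (\<integral>\<^sup>+x. f x \<partial>M)" using qf by (intro nn_integral_cong_AE)
    then show "(\<integral>\<^sup>+x. ennreal (q x) \<partial>M) < \<infinity>" by (simp add: tot)
  qed (auto simp: q_def)
  moreover have "(\<integral>x\<in>G. q x \<partial>M) = \<nu> G" if G: "G \<in> sets F" for G
  proof -
    have [measurable]: "G \<in> sets M" using G by auto
    have "(\<integral>x. q x * indicator G x \<partial>M) = enn2real (\<integral>\<^sup>+x. ennreal (q x * indicator G x) \<partial>M)"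
      by (rule integral_eq_nn_integral) (auto simp: q_def)
    then show ?thesis using qN[OF G] \<nu>0[OF G] by (simp add: set_lebesgue_integral_def mult.commute)
  qed
  ultimately show ?thesis using qF that[of q] by (simp add: q_def)
qed

text \<open>Convergence against sets of \<open>F\<close> extends to simple functions by linearity
  and then to integrable \<open>F\<close>-measurable functions by approximation in mean: indicators
  are at most 1, so the approximation error is uniform in \<open>k\<close>.\<close>

lemma tendsto_integral_indicator:
  fixes \<phi> :: "'t \<Rightarrow> real"
  assumes E: "\<And>k. E k \<in> sets M" "C \<in> sets M"
    and conv: "\<And>G. G \<in> sets F \<Longrightarrow> (\<lambda>k. prob (E k \<inter> G)) \<longlonglongrightarrow> prob (C \<inter> G)"
    and \<phi>: "\<phi> \<in> borel_measurable F" "integrable M \<phi>"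
  shows "(\<lambda>k. \<integral>x. indicator (E k) x * \<phi> x \<partial>M) \<longlonglongrightarrow> (\<integral>x. indicator C x * \<phi> x \<partial>M)"
proof -
  define M' where "M' = restr_to_subalg M F"
  have sM': "sets M' = sets F" using subalg by (simp add: M'_def sets_restr_to_subalg)
  have int: "integrable M (\<lambda>x. indicator S x * f x)" if "integrable M f" "S \<in> sets M" for S and f :: "'t \<Rightarrow> real"
    using integrable_mult_indicator[OF that(2,1)] by simp
  have toM: "integrable M f" if "integrable M' f" for f :: "'t \<Rightarrow> real"
    using that integrable_from_subalg[OF subalg] by (simp add: M'_def)
  have "integrable M' \<phi>" unfolding M'_def using integrable_in_subalg[OF subalg \<phi>] .
  then show ?thesis
  proof (induction rule: integrable_induct)
    case (base A c)
    then have A: "A \<in> sets F" "A \<in> sets M" using sM' by auto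
    have eq: "(\<integral>x. indicator S x * (indicator A x *\<^sub>R c) \<partial>M) = prob (S \<inter> A) * c" if "S \<in> sets M" for S
    proof -
      have "(\<integral>x. indicator S x * (indicator A x *\<^sub>R c) \<partial>M) = (\<integral>x. indicator (S \<inter> A) x * c \<partial>M)"
        by (intro Bochner_Integration.integral_cong) (auto split: split_indicator)
      then show ?thesis using sets.Int[OF that A(2)] by simp
    qed
    show ?case unfolding eq[OF E(1)] eq[OF E(2)] by (intro tendsto_intros conv A)
  next
    case (add f g)
    have "(\<integral>x. indicator S x * (f x + g x) \<partial>M) = (\<integral>x. indicator S x * f x \<partial>M) + (\<integral>x. indicator S x * g x \<partial>M)"
      if "S \<in> sets M" for S
      using int[OF toM[OF add.hyps(1)] that] int[OF toM[OF add.hyps(2)] that] by (simp add: distrib_left)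
    then show ?case using add.IH E by (auto intro: tendsto_add)
  next
    case (lim f s)
    have fM: "integrable M f" and sM: "\<And>i. integrable M (s i)" using lim toM by auto
    have sp: "space M' = space M" by (simp add: M'_def space_restr_to_subalg)
    \<comment> \<open>The approximants satisfy
      \<open>\<bar>s i x\<bar> \<le> 2 * \<bar>f x\<bar>\<close>, which explains the factor 3 in the
      majorant of the difference.\<close>
    have s0: "(\<lambda>i. \<integral>x. \<bar>s i x - f x\<bar> \<partial>M) \<longlonglongrightarrow> (\<integral>x. 0 \<partial>M)"
    proof (rule integral_dominated_convergence[where w="\<lambda>x. 3 * \<bar>f x\<bar>"])
      show "AE x in M. (\<lambda>i. \<bar>s i x - f x\<bar>) \<longlonglongrightarrow> 0"
        using lim(2) sp by (intro AE_I2) (auto intro!: tendsto_rabs_zero simp: LIM_zero_iff)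
      show "AE x in M. norm \<bar>s i x - f x\<bar> \<le> 3 * \<bar>f x\<bar>" for i
      proof (rule AE_I2)
        fix x assume "x \<in> space M"
        then have "\<bar>s i x\<bar> \<le> 2 * \<bar>f x\<bar>" using lim(3)[of x i] sp by simp
        then show "norm \<bar>s i x - f x\<bar> \<le> 3 * \<bar>f x\<bar>" by simp
      qed
    qed (use fM sM in auto)
    have close: "\<bar>(\<integral>x. indicator S x * s i x \<partial>M) - (\<integral>x. indicator S x * f x \<partial>M)\<bar> \<le> (\<integral>x. \<bar>s i x - f x\<bar> \<partial>M)"
      if "S \<in> sets M" for S i
    proof -
      have "(\<integral>x. indicator S x * s i x \<partial>M) - (\<integral>x. indicator S x * f x \<partial>M) = (\<integral>x. indicator S x * s i x - indicator S x * f x \<partial>M)"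
        using int[OF fM that] int[OF sM that] by simp
      also have "\<bar>\<dots>\<bar> \<le> (\<integral>x. \<bar>indicator S x * s i x - indicator S x * f x\<bar> \<partial>M)" by (rule integral_abs_bound)
      also have "\<dots> \<le> (\<integral>x. \<bar>s i x - f x\<bar> \<partial>M)"
        using int[OF fM that] int[OF sM that] fM sM by (intro integral_mono) (auto split: split_indicator)
      finally show ?thesis .
    qed
    show ?case
    proof (rule LIMSEQ_I)
      fix r :: real assume "r > 0"
      then obtain i where i: "(\<integral>x. \<bar>s i x - f x\<bar> \<partial>M) < r / 3"
        using LIMSEQ_D[OF s0, of "r/3"] by (auto simp: abs_less_iff)
      obtain K where K: "\<And>k. k \<ge> K \<Longrightarrow> \<bar>(\<integral>x. indicator (E k) x * s i x \<partial>M) - (\<integral>x. indicator C x * s i x \<partial>M)\<bar> < r / 3"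
        using LIMSEQ_D[OF lim(5)[of i], of "r/3"] \<open>r > 0\<close> by (auto simp: real_norm_def)
      have "\<bar>(\<integral>x. indicator (E k) x * f x \<partial>M) - (\<integral>x. indicator C x * f x \<partial>M)\<bar> < r" if "k \<ge> K" for k
        using K[OF that] close[OF E(1)[of k], of i] close[OF E(2), of i] i by argo
      then show "\<exists>K. \<forall>k\<ge>K. norm ((\<integral>x. indicator (E k) x * f x \<partial>M) - (\<integral>x. indicator C x * f x \<partial>M)) < r"
        by (intro exI[of _ K]) (simp add: real_norm_def)
    qed
  qed
qed

text \<open>By uniqueness \<open>q\<close> is a version of the conditional probability of
  \<open>C\<close>, and the \<open>F\<close>-measurable factor \<open>\<phi>\<close> may be pulled
  out of the conditional expectation. So a purified strategy earns what the mixed one earns.\<close>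

lemma integral_indicator_eq_density:
  fixes \<phi> :: "'t \<Rightarrow> real"
  assumes C: "C \<in> sets M" and q: "q \<in> borel_measurable F" "integrable M q"
    and eq: "\<And>G. G \<in> sets F \<Longrightarrow> prob (C \<inter> G) = (\<integral>x\<in>G. q x \<partial>M)"
    and \<phi>: "\<phi> \<in> borel_measurable F" "integrable M \<phi>"
  shows "(\<integral>x. indicator C x * \<phi> x \<partial>M) = (\<integral>x. q x * \<phi> x \<partial>M)"
proof -
  have int: "integrable M (\<lambda>x. \<phi> x * indicator C x)"
    using integrable_real_mult_indicator[OF C \<phi>(2)] .
  have "AE x in M. real_cond_exp M F (indicator C) x = q x"
  proof (rule real_cond_exp_charact)
    fix G assume "G \<in> sets F"
    then show "(\<integral>x\<in>G. indicator C x \<partial>M) = (\<integral>x\<in>G. q x \<partial>M)"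
      using set_integral_cond_prob[OF C] real_cond_exp_intA[of "indicator C" G] eq C
      by (simp add: cond_prob_def emeasure_eq_measure)
  qed (use C q in \<open>auto simp: emeasure_eq_measure\<close>)
  then have "(\<integral>x. \<phi> x * real_cond_exp M F (indicator C) x \<partial>M) = (\<integral>x. \<phi> x * q x \<partial>M)"
    using q \<phi> by (intro integral_cong_AE) (auto intro!: borel_measurable_times F_measurable)
  then show ?thesis
    using real_cond_exp_intg(2)[OF int \<phi>(1)] C by (simp add: mult.commute)
qed

end

section \<open>The game: measurability, dominated convergence and finite-valued profiles\<close>

text \<open>The locale requires the information structure for all indices, not only for players;
  in the theorem the measures outside \<open>I\<close> are replaced by the one of an arbitrary player.\<close>

locale incomplete_information_game =
  fixes I :: "'i set" and A :: "'i \<Rightarrow> 'a::metric_space set" and T F :: "'i \<Rightarrow> 't measure"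
    and u :: "'i \<Rightarrow> ('i \<Rightarrow> 'a) \<Rightarrow> 't \<Rightarrow> real" and h :: "'i \<Rightarrow> 't \<Rightarrow> real"
    and \<rho> :: "'i \<Rightarrow> nat \<Rightarrow> 'a \<Rightarrow> 'a"
  assumes finite_I: "finite I"
    and information: "\<And>i. nowhere_equivalent_subalgebra (T i) (F i)"
    and F_countably_generated: "\<And>i. countably_generated (F i)"
    and A_compact: "\<And>i. i \<in> I \<Longrightarrow> compact (A i)" and A_nonempty: "\<And>i. i \<in> I \<Longrightarrow> A i \<noteq> {}"
    and u_measurable: "\<And>i. i \<in> I \<Longrightarrow>
      case_prod (u i) \<in> borel_measurable (PiM I (\<lambda>j. action_space (A j)) \<Otimes>\<^sub>M F i)"
    and u_continuous: "\<And>i t. i \<in> I \<Longrightarrow> t \<in> space (T i) \<Longrightarrow> continuous_on (PiE I A) (\<lambda>a. u i a t)"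
    and h_integrable: "\<And>i. i \<in> I \<Longrightarrow> integrable (T i) (h i)"
    and u_bound: "\<And>i a t. i \<in> I \<Longrightarrow> a \<in> PiE I A \<Longrightarrow> t \<in> space (T i) \<Longrightarrow> \<bar>u i a t\<bar> \<le> h i t"
    and \<rho>_measurable: "\<And>i n. i \<in> I \<Longrightarrow> \<rho> i n \<in> measurable (action_space (A i)) (action_space (A i))"
    and \<rho>_finite: "\<And>i n. i \<in> I \<Longrightarrow> finite (\<rho> i n ` A i)"
    and \<rho>_\<rho>: "\<And>i n k a. i \<in> I \<Longrightarrow> n \<le> k \<Longrightarrow> a \<in> A i \<Longrightarrow> \<rho> i n (\<rho> i k a) = \<rho> i n a"
    and \<rho>_close: "\<And>i \<epsilon>. i \<in> I \<Longrightarrow> \<epsilon> > 0 \<Longrightarrow> \<exists>N. \<forall>n\<ge>N. \<forall>a\<in>A i. dist (\<rho> i n a) a < \<epsilon>"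
begin

sublocale info: nowhere_equivalent_subalgebra "T i" "F i" for i
  by (rule information)

sublocale product_prob_space T I
  by (simp add: product_prob_space_def product_prob_space_axioms_def product_sigma_finite_def
      info.prob_space_axioms info.sigma_finite_measure_axioms)

abbreviation "strat i \<equiv> pure_strategies (T i) (A i)"
abbreviation "pay i f \<equiv> payoff I (PiM I T) (u i) i f"
abbreviation "prof f t \<equiv> (\<lambda>j\<in>I. f j (t j))"
definition choice_event :: "'i \<Rightarrow> ('t \<Rightarrow> 'a) \<Rightarrow> 'a \<Rightarrow> 't set" where
  "choice_event i Y s = space (T i) \<inter> Y -` {s}"

lemma space_action [simp]: "space (action_space S) = S"
  by (simp add: action_space_def space_restrict_space)

lemma \<rho>_in_A: "i \<in> I \<Longrightarrow> a \<in> A i \<Longrightarrow> \<rho> i n a \<in> A i"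
  using measurable_space[OF \<rho>_measurable, of i a n] by simp

lemma strat_in_A: "f \<in> strat i \<Longrightarrow> t \<in> space (T i) \<Longrightarrow> f t \<in> A i"
  using measurable_space[of f "T i" "action_space (A i)"] by (simp add: pure_strategies_def)

lemma \<rho>_strat: "i \<in> I \<Longrightarrow> f \<in> strat i \<Longrightarrow> (\<lambda>t. \<rho> i n (f t)) \<in> strat i"
  unfolding pure_strategies_def using \<rho>_measurable measurable_compose by blast

lemma choice_event_measurable: "f \<in> strat i \<Longrightarrow> choice_event i f s \<in> sets (T i)"
proof -
  assume f: "f \<in> strat i"
  show ?thesis
  proof (cases "s \<in> A i")
    case True
    have "A i \<inter> {s} \<in> sets (action_space (A i))"
      by (auto simp: action_space_def sets_restrict_space)
    then have "f -` (A i \<inter> {s}) \<inter> space (T i) \<in> sets (T i)"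
      using f unfolding pure_strategies_def by (rule measurable_sets[rotated])
    moreover have "f -` (A i \<inter> {s}) \<inter> space (T i) = choice_event i f s"
      using True by (auto simp: choice_event_def)
    ultimately show ?thesis by simp
  next
    case False
    then have "choice_event i f s = {}" using strat_in_A[OF f] by (auto simp: choice_event_def)
    then show ?thesis by simp
  qed
qed

lemma finite_valued_strat:
  assumes "finite X" "X \<subseteq> A i" "\<And>t. t \<in> space (T i) \<Longrightarrow> f t \<in> X" "\<And>s. s \<in> X \<Longrightarrow> choice_event i f s \<in> sets (T i)"
  shows "f \<in> strat i"
  unfolding pure_strategies_def
proof (rule measurableI)
  fix t assume "t \<in> space (T i)" then show "f t \<in> space (action_space (A i))" using assms by auto
next
  fix S assume "S \<in> sets (action_space (A i))"
  have "f -` S \<inter> space (T i) = (\<Union>s\<in>X \<inter> S. choice_event i f s)" using assms(3) by (auto simp: choice_event_def)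
  then show "f -` S \<inter> space (T i) \<in> sets (T i)" using assms by auto
qed

lemma prof_in_A:
  assumes "\<And>j. j \<in> I \<Longrightarrow> f j \<in> strat j" "t \<in> space (PiM I T)"
  shows "prof f t \<in> PiE I A"
  using assms strat_in_A by (auto simp: space_PiM PiE_iff)

lemma player_type_in_space: "i \<in> I \<Longrightarrow> t \<in> space (PiM I T) \<Longrightarrow> t i \<in> space (T i)"
  by (auto simp: space_PiM)

lemma measurable_payoff_integrand:
  assumes i: "i \<in> I" and f: "\<And>j. j \<in> I \<Longrightarrow> f j \<in> strat j"
  shows "(\<lambda>t. u i (prof f t) (t i)) \<in> borel_measurable (PiM I T)"
proof -
  have "(\<lambda>t. f j (t j)) \<in> measurable (PiM I T) (action_space (A j))" if "j \<in> I" for j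
    using f[OF that] measurable_component_singleton[OF that, of T]
    by (auto simp: pure_strategies_def intro: measurable_compose)
  then have 1: "(\<lambda>t. prof f t) \<in> measurable (PiM I T) (PiM I (\<lambda>j. action_space (A j)))"
    by (rule measurable_restrict)
  \<comment> \<open>The utility is measurable for the coarser \<open>F i\<close>, while the product
    carries \<open>T i\<close>; the identity from the finer to the coarser structure bridges the
    two.\<close>
  have "(\<lambda>x. x) \<in> measurable (T i) (F i)"
    using info.F_in_sets[of _ i] sets.sets_into_space[of _ "F i"]
    by (intro measurableI) (auto simp: Int_absorb2)
  then have 2: "(\<lambda>t. t i) \<in> measurable (PiM I T) (F i)"
    using measurable_component_singleton[OF i, of T] by (auto intro: measurable_compose)
  from measurable_compose[OF measurable_Pair[OF 1 2] u_measurable[OF i]] show ?thesis by simp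
qed

lemma integrable_component:
  fixes g :: "'t \<Rightarrow> real"
  assumes "i \<in> I" "integrable (T i) g"
  shows "integrable (PiM I T) (\<lambda>t. g (t i))"
  using assms PiM_component[OF assms(1)] integrable_distr[of "\<lambda>t. t i" "PiM I T" "T i" g]
  by simp

lemma u_component_measurable:
  assumes i: "i \<in> I" and b: "b \<in> PiE I A"
  shows "u i b \<in> borel_measurable (F i)"
proof -
  have "b \<in> space (PiM I (\<lambda>j. action_space (A j)))" using b by (simp add: space_PiM PiE_iff)
  from measurable_compose[OF measurable_Pair1'[OF this] u_measurable[OF i]] show ?thesis by simp
qed

lemma u_component_integrable:
  assumes i: "i \<in> I" and b: "b \<in> PiE I A"
  shows "integrable (T i) (u i b)"
  by (rule Bochner_Integration.integrable_bound[OF h_integrable[OF i]])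
    (use u_bound[OF i b] u_component_measurable[OF i b] info.F_measurable in \<open>auto intro!: AE_I2 order_trans[OF _ abs_ge_self]\<close>)

lemma integrable_payoff_integrand:
  assumes i: "i \<in> I" and f: "\<And>j. j \<in> I \<Longrightarrow> f j \<in> strat j"
  shows "integrable (PiM I T) (\<lambda>t. u i (prof f t) (t i))"
proof (rule Bochner_Integration.integrable_bound[OF integrable_component[OF i h_integrable[OF i]]])
  show "AE t in PiM I T. norm (u i (prof f t) (t i)) \<le> norm (h i (t i))"
  proof (rule AE_I2)
    fix t assume t: "t \<in> space (PiM I T)"
    show "norm (u i (prof f t) (t i)) \<le> norm (h i (t i))"
      using u_bound[OF i prof_in_A[OF f t] player_type_in_space[OF i t]] by simp
  qed
qed (rule measurable_payoff_integrand[OF i f])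

text \<open>Dominated convergence with majorant \<open>2 * h i\<close>. It is phrased for
  differences because it must also cover two sequences of payoffs neither of which is known to
  converge.\<close>

lemma payoff_difference_tendsto_0:
  assumes i: "i \<in> I" and f: "\<And>k j. j \<in> I \<Longrightarrow> f k j \<in> strat j" and g: "\<And>k j. j \<in> I \<Longrightarrow> g k j \<in> strat j"
    and lim: "\<And>t. t \<in> space (PiM I T) \<Longrightarrow>
      (\<lambda>k. u i (prof (f k) t) (t i) - u i (prof (g k) t) (t i)) \<longlonglongrightarrow> 0"
  shows "(\<lambda>k. pay i (f k) - pay i (g k)) \<longlonglongrightarrow> 0"
proof -
  have "(\<lambda>k. \<integral>t. u i (prof (f k) t) (t i) - u i (prof (g k) t) (t i) \<partial>PiM I T) \<longlonglongrightarrow> (\<integral>t. 0 \<partial>PiM I T)"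
  proof (rule integral_dominated_convergence)
    show "integrable (PiM I T) (\<lambda>t. 2 * h i (t i))"
      using integrable_component[OF i h_integrable[OF i]] by simp
    show "AE t in PiM I T. norm (u i (prof (f k) t) (t i) - u i (prof (g k) t) (t i)) \<le> 2 * h i (t i)" for k
    proof (rule AE_I2)
      fix t assume t: "t \<in> space (PiM I T)"
      show "norm (u i (prof (f k) t) (t i) - u i (prof (g k) t) (t i)) \<le> 2 * h i (t i)"
        using u_bound[OF i prof_in_A[of "f k", OF f t] player_type_in_space[OF i t]]
          u_bound[OF i prof_in_A[of "g k", OF g t] player_type_in_space[OF i t]] by simp
    qed
    show "AE t in PiM I T. (\<lambda>k. u i (prof (f k) t) (t i) - u i (prof (g k) t) (t i)) \<longlonglongrightarrow> 0"
      using lim by (rule AE_I2)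
    show "(\<lambda>t. u i (prof (f k) t) (t i) - u i (prof (g k) t) (t i)) \<in> borel_measurable (PiM I T)" for k
      by (intro borel_measurable_diff measurable_payoff_integrand[OF i] f g)
  qed simp
  then show ?thesis
    using integrable_payoff_integrand[OF i f] integrable_payoff_integrand[OF i g] by (simp add: payoff_def)
qed

lemma u_tendsto:
  assumes i: "i \<in> I" and t: "t \<in> space (T i)" and x: "\<And>k. x k \<in> PiE I A" "y \<in> PiE I A"
    and lim: "\<And>j. j \<in> I \<Longrightarrow> (\<lambda>k. x k j) \<longlonglongrightarrow> y j"
  shows "(\<lambda>k. u i (x k) t) \<longlonglongrightarrow> u i y t"
proof -
  \<comment> \<open>Continuity on \<open>PiE I A\<close> refers to the product topology over all
    indices of the type. Outside \<open>I\<close> every member of \<open>PiE\<close> takes the same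
    default value, so convergence there is trivial.\<close>
  have "(\<lambda>k. x k j) \<longlonglongrightarrow> y j" for j
  proof (cases "j \<in> I")
    case False
    then have "x k j = y j" for k using x by (metis PiE_arb)
    then show ?thesis by simp
  qed (rule lim)
  then have "limitin (product_topology (\<lambda>_. euclidean) UNIV) x y sequentially"
    by (simp add: limitin_componentwise)
  then have "x \<longlonglongrightarrow> y"
    by (simp add: euclidean_product_topology)
  from continuous_on_tendsto_compose[OF u_continuous[OF i t] this x(2)] show ?thesis
    using x by simp
qed

text \<open>Uniform continuity in the actions, in sequential form: \<open>x\<close> itself need not
  converge. Were the difference to stay above some \<epsilon> along a subsequence, compactness would
  make \<open>x\<close> converge along a further one; the discretized profiles then have the same
  limit, and continuity gives a contradiction.\<close>

lemma uniform_discretization: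
  assumes i: "i \<in> I" and t: "t \<in> space (T i)" and x: "\<And>k. x k \<in> PiE I A"
    and n: "filterlim n at_top sequentially"
  shows "(\<lambda>k. u i (x k) t - u i (\<lambda>j\<in>I. \<rho> j (n k) (x k j)) t) \<longlonglongrightarrow> 0"
proof (rule ccontr)
  let ?d = "\<lambda>k. u i (x k) t - u i (\<lambda>j\<in>I. \<rho> j (n k) (x k j)) t"
  assume "\<not> ?d \<longlonglongrightarrow> 0"
  then obtain \<epsilon> where "\<epsilon> > 0" "\<And>N. \<exists>k\<ge>N. \<not> \<bar>?d k\<bar> < \<epsilon>"
    unfolding LIMSEQ_iff by auto
  then have "\<exists>\<^sub>F k in sequentially. \<not> \<bar>?d k\<bar> < \<epsilon>" by (auto simp: frequently_sequentially)
  then obtain r :: "nat \<Rightarrow> nat" where r: "strict_mono r" "\<And>k. \<not> \<bar>?d (r k)\<bar> < \<epsilon>"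
    using infinite_enumerate[of "{k. \<not> \<bar>?d k\<bar> < \<epsilon>}"]
    by (auto simp: frequently_cofinite cofinite_eq_sequentially[symmetric])
  obtain r' y where r': "strict_mono r'" and y: "\<And>j. j \<in> I \<Longrightarrow> y j \<in> A j \<and> (\<lambda>k. x (r (r' k)) j) \<longlonglongrightarrow> y j"
    using countable_family_convergent_subsequence[of I A "\<lambda>k. x (r k)"] finite_I A_compact x
    by (auto simp: countable_finite PiE_iff)
  define z where "z = restrict y I"
  have z: "z \<in> PiE I A" using y by (auto simp: z_def)
  have xz: "(\<lambda>k. x (r (r' k)) j) \<longlonglongrightarrow> z j" if "j \<in> I" for j using y that by (simp add: z_def)
  have xA: "x k j \<in> A j" if "j \<in> I" for k j using x that by (auto simp: PiE_iff)
  have nr: "filterlim (\<lambda>k. n (r (r' k))) at_top sequentially"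
    using n r(1) r' by (intro filterlim_compose[OF n] filterlim_compose[OF filterlim_subseq[OF r(1)]] filterlim_subseq)
  have \<rho>z: "(\<lambda>k. \<rho> j (n (r (r' k))) (x (r (r' k)) j)) \<longlonglongrightarrow> z j" if j: "j \<in> I" for j
  proof -
    have "(\<lambda>k. dist (\<rho> j (n (r (r' k))) (x (r (r' k)) j)) (x (r (r' k)) j)) \<longlonglongrightarrow> 0"
    proof (rule tendstoI)
      fix e :: real assume "e > 0"
      then obtain N where N: "\<And>m a. m \<ge> N \<Longrightarrow> a \<in> A j \<Longrightarrow> dist (\<rho> j m a) a < e" using \<rho>_close[OF j] by blast
      have "\<forall>\<^sub>F k in sequentially. n (r (r' k)) \<ge> N" using nr by (simp add: filterlim_at_top)
      then show "\<forall>\<^sub>F k in sequentially. dist (dist (\<rho> j (n (r (r' k))) (x (r (r' k)) j)) (x (r (r' k)) j)) 0 < e"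
        by eventually_elim (use N xA[OF j] in simp)
    qed
    from tendsto_add[OF this iffD1[OF tendsto_dist_iff xz[OF j]]]
    have "(\<lambda>k. dist (\<rho> j (n (r (r' k))) (x (r (r' k)) j)) (x (r (r' k)) j) + dist (x (r (r' k)) j) (z j)) \<longlonglongrightarrow> 0"
      by simp
    from tendsto_sandwich[OF _ _ tendsto_const this]
    have "(\<lambda>k. dist (\<rho> j (n (r (r' k))) (x (r (r' k)) j)) (z j)) \<longlonglongrightarrow> 0"
      by (simp add: dist_triangle)
    then show ?thesis by (rule iffD2[OF tendsto_dist_iff])
  qed
  have ux: "(\<lambda>k. u i (x (r (r' k))) t) \<longlonglongrightarrow> u i z t"
    by (rule u_tendsto[OF i t x z xz])
  have u\<rho>: "(\<lambda>k. u i (\<lambda>j\<in>I. \<rho> j (n (r (r' k))) (x (r (r' k)) j)) t) \<longlonglongrightarrow> u i z t"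
    using \<rho>z xA \<rho>_in_A by (intro u_tendsto[OF i t _ z]) auto
  have "(\<lambda>k. ?d (r (r' k))) \<longlonglongrightarrow> 0" using tendsto_diff[OF ux u\<rho>] by simp
  then obtain k where "\<bar>?d (r (r' k))\<bar> < \<epsilon>"
    using \<open>\<epsilon> > 0\<close> by (auto simp: LIMSEQ_iff)
  then show False using r(2) by blast
qed

text \<open>By independence the payoff depends on the opponents only through the laws of their actions.\<close>

lemma payoff_finite_valued:
  assumes i: "i \<in> I" and X: "\<And>j. j \<in> I \<Longrightarrow> finite (X j)" "\<And>j. j \<in> I \<Longrightarrow> X j \<subseteq> A j"
    and Y: "\<And>j. j \<in> I \<Longrightarrow> Y j \<in> strat j" "\<And>j t. j \<in> I \<Longrightarrow> t \<in> space (T j) \<Longrightarrow> Y j t \<in> X j"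
  shows "pay i Y = (\<Sum>b\<in>PiE I X. (\<integral>t. indicator (choice_event i (Y i) (b i)) t * u i b t \<partial>T i) *
     (\<Prod>j\<in>I - {i}. measure (T j) (choice_event j (Y j) (b j))))"
proof -
  \<comment> \<open>The product of the \<open>g b j\<close> over \<open>j\<close> is the indicator
    of the event that profile \<open>b\<close> is played, times the utility from \<open>b\<close>,
    which is placed in the factor of player \<open>i\<close>. Each factor depends on a single type,
    so the integral of the product splits.\<close>
  define g where "g b j \<tau> = (if j = i then indicator (choice_event i (Y i) (b i)) \<tau> * u i b \<tau>
     else indicator (choice_event j (Y j) (b j)) \<tau>)" for b j \<tau>
  have XA: "PiE I X \<subseteq> PiE I A" using X(2) by (rule PiE_mono)
  have fin: "finite (PiE I X)" using finite_I X(1) by (rule finite_PiE)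
  have gint: "integrable (T j) (g b j)" if "b \<in> PiE I X" "j \<in> I" for b j
  proof (cases "j = i")
    case True
    then show ?thesis
      using integrable_mult_indicator[OF choice_event_measurable[OF Y(1)[OF i]] u_component_integrable[OF i]] that XA
      by (auto simp: g_def[abs_def])
  next
    case False
    then show ?thesis using choice_event_measurable[OF Y(1)[OF that(2)]] by (simp add: g_def[abs_def] info.emeasure_eq_measure)
  qed
  have pw: "u i (prof Y t) (t i) = (\<Sum>b\<in>PiE I X. \<Prod>j\<in>I. g b j (t j))" if t: "t \<in> space (PiM I T)" for t
  proof -
    have tj: "t j \<in> space (T j)" if "j \<in> I" for j using player_type_in_space that t by blast
    have prof: "prof Y t \<in> PiE I X" using Y(2) tj by auto
    have "(\<Prod>j\<in>I. g b j (t j)) = (if b = prof Y t then u i b (t i) else 0)" if b: "b \<in> PiE I X" for b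
    proof (cases "b = prof Y t")
      case True
      then have "t j \<in> choice_event j (Y j) (b j)" if "j \<in> I" for j
        using that tj by (simp add: choice_event_def)
      then have "g b j (t j) = (if j = i then u i b (t i) else 1)" if "j \<in> I" for j
        using that i by (simp add: g_def)
      then have "(\<Prod>j\<in>I. g b j (t j)) = (\<Prod>j\<in>I. if j = i then u i b (t i) else 1)" by (intro prod.cong) auto
      then show ?thesis using True i finite_I by (simp add: prod.delta)
    next
      case False
      then have "\<exists>j\<in>I. b j \<noteq> prof Y t j" using PiE_ext[OF b prof] by blast
      then obtain j where "j \<in> I" "b j \<noteq> Y j (t j)" by auto
      then have "g b j (t j) = 0" by (auto simp: g_def choice_event_def)
      then show ?thesis using False \<open>j \<in> I\<close> finite_I by auto
    qed
    then have "(\<Sum>b\<in>PiE I X. \<Prod>j\<in>I. g b j (t j)) = (\<Sum>b\<in>PiE I X. if b = prof Y t then u i b (t i) else 0)"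
      by (intro sum.cong) auto
    then show ?thesis using fin prof by (simp add: sum.delta)
  qed
  have "pay i Y = (\<integral>t. (\<Sum>b\<in>PiE I X. \<Prod>j\<in>I. g b j (t j)) \<partial>PiM I T)"
    unfolding payoff_def by (intro Bochner_Integration.integral_cong pw) auto
  also have "\<dots> = (\<Sum>b\<in>PiE I X. \<integral>t. (\<Prod>j\<in>I. g b j (t j)) \<partial>PiM I T)"
    using product_integrable_prod[OF finite_I gint] by (intro Bochner_Integration.integral_sum) auto
  also have "\<dots> = (\<Sum>b\<in>PiE I X. \<Prod>j\<in>I. \<integral>\<tau>. g b j \<tau> \<partial>T j)"
    using product_integral_prod[OF finite_I gint] by (intro sum.cong) auto
  also have "\<dots> = (\<Sum>b\<in>PiE I X. (\<integral>t. indicator (choice_event i (Y i) (b i)) t * u i b t \<partial>T i) *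
     (\<Prod>j\<in>I - {i}. measure (T j) (choice_event j (Y j) (b j))))"
  proof (intro sum.cong refl)
    fix b
    have "(\<Prod>j\<in>I. \<integral>\<tau>. g b j \<tau> \<partial>T j) = (\<integral>\<tau>. g b i \<tau> \<partial>T i) * (\<Prod>j\<in>I - {i}. \<integral>\<tau>. g b j \<tau> \<partial>T j)"
      using finite_I i by (rule prod.remove)
    also have "(\<Prod>j\<in>I - {i}. \<integral>\<tau>. g b j \<tau> \<partial>T j) = (\<Prod>j\<in>I - {i}. measure (T j) (choice_event j (Y j) (b j)))"
      using choice_event_measurable Y(1) by (intro prod.cong) (auto simp: g_def)
    finally show "(\<Prod>j\<in>I. \<integral>\<tau>. g b j \<tau> \<partial>T j) = (\<integral>t. indicator (choice_event i (Y i) (b i)) t * u i b t \<partial>T i) *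
     (\<Prod>j\<in>I - {i}. measure (T j) (choice_event j (Y j) (b j)))" by (simp add: g_def)
  qed
  finally show ?thesis .
qed

end

section \<open>Smoothed best replies\<close>

text \<open>A polynomial rather than exponential soft maximum: the numerator vanishes as soon as
  some action beats \<open>s\<close> by \<epsilon> or more. Hence only actions less than \<epsilon>
  below the best get weight, yet the weights are continuous in \<open>w\<close>, unlike an exact
  maximizer.\<close>

definition soft_max :: "real \<Rightarrow> 'b set \<Rightarrow> ('b \<Rightarrow> real) \<Rightarrow> 'b \<Rightarrow> real" where
  "soft_max \<epsilon> C w s = (\<Prod>c\<in>C. max 0 (w s - w c + \<epsilon>)) / (\<Sum>s'\<in>C. \<Prod>c\<in>C. max 0 (w s' - w c + \<epsilon>))"

text \<open>At a maximizer of \<open>w\<close> every factor is at least \<epsilon>.\<close>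

lemma soft_max_denominator_pos:
  assumes "finite C" "C \<noteq> {}" "\<epsilon> > (0::real)"
  shows "(\<Sum>s'\<in>C. \<Prod>c\<in>C. max 0 (w s' - w c + \<epsilon>)) > 0"
proof -
  have "Max (w ` C) \<in> w ` C" using assms by simp
  then obtain s where s: "s \<in> C" "w s = Max (w ` C)" by auto
  have "w c \<le> w s" if "c \<in> C" for c using s that assms(1) by simp
  then have "(\<Prod>c\<in>C. max 0 (w s - w c + \<epsilon>)) > 0"
    using assms(3) by (intro prod_pos) (fastforce simp: less_max_iff_disj intro: add_nonneg_pos)
  then show ?thesis using assms s by (intro sum_pos2[of C s]) (auto intro: prod_nonneg)
qed

lemma soft_max_nonneg: "soft_max \<epsilon> C w s \<ge> 0"
  unfolding soft_max_def by (intro divide_nonneg_nonneg sum_nonneg prod_nonneg) auto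

lemma sum_soft_max:
  assumes "finite C" "C \<noteq> {}" "\<epsilon> > 0"
  shows "(\<Sum>s\<in>C. soft_max \<epsilon> C w s) = 1"
  using soft_max_denominator_pos[OF assms, of w] by (simp add: soft_max_def sum_divide_distrib[symmetric])

lemma soft_max_le_1:
  assumes "finite C" "\<epsilon> > 0" "s \<in> C"
  shows "soft_max \<epsilon> C w s \<le> 1"
  using member_le_sum[of s C "soft_max \<epsilon> C w"] sum_soft_max[of C \<epsilon> w] assms soft_max_nonneg by fastforce

lemma soft_max_optimal:
  assumes C: "finite C" "\<epsilon> > 0" "c \<in> C"
  shows "w c \<le> (\<Sum>s\<in>C. soft_max \<epsilon> C w s * w s) + \<epsilon>"
proof -
  have 1: "(\<Sum>s\<in>C. soft_max \<epsilon> C w s) = 1" using sum_soft_max C by blast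
  \<comment> \<open>Either \<open>s\<close> is within \<epsilon> of \<open>c\<close>, or its weight
    is 0 because the factor for \<open>c\<close> vanishes. Summing against total weight 1 gives the
    claim.\<close>
  have "soft_max \<epsilon> C w s * (w c - \<epsilon>) \<le> soft_max \<epsilon> C w s * w s" if "s \<in> C" for s
  proof (cases "w s - w c + \<epsilon> \<ge> 0")
    case True then show ?thesis using soft_max_nonneg by (intro mult_left_mono) auto
  next
    case False
    then have "\<exists>c\<in>C. max 0 (w s - w c + \<epsilon>) = 0" using C(3) by (intro bexI[of _ c]) simp_all
    then have "(\<Prod>c\<in>C. max 0 (w s - w c + \<epsilon>)) = 0" by (rule prod_zero[OF C(1)])
    then show ?thesis by (simp add: soft_max_def)
  qed
  then have "(\<Sum>s\<in>C. soft_max \<epsilon> C w s * (w c - \<epsilon>)) \<le> (\<Sum>s\<in>C. soft_max \<epsilon> C w s * w s)"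
    by (rule sum_mono)
  then show ?thesis using 1 by (simp add: sum_distrib_right[symmetric])
qed

lemma soft_max_tendsto:
  assumes C: "finite C" "\<epsilon> > 0" "s \<in> C" and w: "\<And>c. c \<in> C \<Longrightarrow> ((\<lambda>k. w k c) \<longlongrightarrow> v c) \<F>"
  shows "((\<lambda>k. soft_max \<epsilon> C (w k) s) \<longlongrightarrow> soft_max \<epsilon> C v s) \<F>"
proof -
  have "C \<noteq> {}" using C(3) by auto
  then show ?thesis
    unfolding soft_max_def using soft_max_denominator_pos[OF C(1) _ C(2), of v] C(3)
    by (intro tendsto_intros w) auto
qed

lemma soft_max_measurable:
  assumes "finite C" "s \<in> C" and [measurable]: "\<And>c. c \<in> C \<Longrightarrow> (\<lambda>t. w t c) \<in> borel_measurable N"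
  shows "(\<lambda>t. soft_max \<epsilon> C (w t) s) \<in> borel_measurable N"
  unfolding soft_max_def using assms
  by (intro borel_measurable_divide borel_measurable_prod borel_measurable_sum borel_measurable_max
      borel_measurable_add borel_measurable_diff borel_measurable_const)

section \<open>Continuity of payoffs and compactness of strategy profiles\<close>

context incomplete_information_game
begin

text \<open>A three-term estimate through the discretized profiles \<open>Y' n k\<close> and
  \<open>Z n\<close>. For fixed \<open>n\<close> the finite payoff formula passes to the limit in
  \<open>k\<close>; the payoffs of \<open>Z n\<close> tend to that of \<open>f\<close> by dominated
  convergence; and \<open>Y' n k\<close> approximates \<open>Y k\<close> uniformly in
  \<open>k\<close>, so \<open>n\<close> can be fixed before \<open>k\<close>. Convergence against
  every \<open>G\<close> in \<open>F j\<close> serves the player's own integral, which weights the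
  choice event by a type-dependent utility.\<close>

lemma payoff_tendsto:
  assumes i: "i \<in> I"
    and Y: "\<And>k j. j \<in> I \<Longrightarrow> Y k j \<in> strat j" and Z: "\<And>n j. j \<in> I \<Longrightarrow> Z n j \<in> strat j"
    and ZX: "\<And>n j t. j \<in> I \<Longrightarrow> t \<in> space (T j) \<Longrightarrow> Z n j t \<in> \<rho> j n ` A j"
    and f: "\<And>j. j \<in> I \<Longrightarrow> f j \<in> strat j"
    and conv: "\<And>j n s G. j \<in> I \<Longrightarrow> s \<in> \<rho> j n ` A j \<Longrightarrow> G \<in> sets (F j) \<Longrightarrow>
      (\<lambda>k. measure (T j) (choice_event j (\<lambda>t. \<rho> j n (Y k j t)) s \<inter> G)) \<longlonglongrightarrow>
      measure (T j) (choice_event j (Z n j) s \<inter> G)"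
    and lim: "\<And>j t. j \<in> I \<Longrightarrow> t \<in> space (T j) \<Longrightarrow> (\<lambda>n. Z n j t) \<longlonglongrightarrow> f j t"
  shows "(\<lambda>k. pay i (Y k)) \<longlonglongrightarrow> pay i f"
proof -
  define Y' where "Y' n k j t = \<rho> j n (Y k j t)" for n k j t
  have Y': "Y' n k j \<in> strat j" if "j \<in> I" for n k j
    unfolding Y'_def[abs_def] using \<rho>_strat[OF that Y[OF that]] .
  have Y'X: "Y' n k j t \<in> \<rho> j n ` A j" if "j \<in> I" "t \<in> space (T j)" for n k j t
    unfolding Y'_def using strat_in_A[OF Y[OF that(1)] that(2)] by blast
  have XA: "\<rho> j n ` A j \<subseteq> A j" if "j \<in> I" for j n using \<rho>_in_A[OF that] by blast
  have level: "(\<lambda>k. pay i (Y' n k)) \<longlonglongrightarrow> pay i (Z n)" for n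
  proof -
    have conv': "(\<lambda>k. measure (T j) (choice_event j (Y' n k j) s \<inter> G)) \<longlonglongrightarrow>
      measure (T j) (choice_event j (Z n j) s \<inter> G)" if "j \<in> I" "s \<in> \<rho> j n ` A j" "G \<in> sets (F j)" for j s G
      unfolding Y'_def[abs_def] using conv[OF that] .
    have 1: "(\<lambda>k. \<integral>t. indicator (choice_event i (Y' n k i) (b i)) t * u i b t \<partial>T i) \<longlonglongrightarrow>
        (\<integral>t. indicator (choice_event i (Z n i) (b i)) t * u i b t \<partial>T i)" if b: "b \<in> (\<Pi>\<^sub>E j\<in>I. \<rho> j n ` A j)" for b
    proof -
      have bA: "b \<in> PiE I A" using PiE_mono[of I "\<lambda>j. \<rho> j n ` A j" A] XA b by blast
      show ?thesis
        using b i by (intro info.tendsto_integral_indicator choice_event_measurable Y' Z conv'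
            u_component_measurable u_component_integrable bA) auto
    qed
    \<comment> \<open>Opponents enter only through unconditional laws, the case where
      \<open>G\<close> is the whole space.\<close>
    have 2: "(\<lambda>k. measure (T j) (choice_event j (Y' n k j) s)) \<longlonglongrightarrow> measure (T j) (choice_event j (Z n j) s)"
      if "j \<in> I" "s \<in> \<rho> j n ` A j" for j s
      using conv'[OF that sets.top] by (simp add: choice_event_def Int_absorb2 Int_assoc Int_commute[of _ "space (T j)"])
    have "pay i (Y' n k) = (\<Sum>b\<in>(\<Pi>\<^sub>E j\<in>I. \<rho> j n ` A j). (\<integral>t. indicator (choice_event i (Y' n k i) (b i)) t * u i b t \<partial>T i) *
       (\<Prod>j\<in>I - {i}. measure (T j) (choice_event j (Y' n k j) (b j))))" for k
      by (rule payoff_finite_valued[OF i \<rho>_finite XA Y' Y'X])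
    moreover have "pay i (Z n) = (\<Sum>b\<in>(\<Pi>\<^sub>E j\<in>I. \<rho> j n ` A j). (\<integral>t. indicator (choice_event i (Z n i) (b i)) t * u i b t \<partial>T i) *
       (\<Prod>j\<in>I - {i}. measure (T j) (choice_event j (Z n j) (b j))))"
      by (rule payoff_finite_valued[OF i \<rho>_finite XA Z ZX])
    ultimately show ?thesis
      by (simp only:) (intro tendsto_sum tendsto_mult tendsto_prod 1 2, auto)
  qed
  have Zf: "(\<lambda>n. pay i (Z n)) \<longlonglongrightarrow> pay i f"
  proof -
    have "(\<lambda>n. pay i (Z n) - pay i f) \<longlonglongrightarrow> 0"
    proof (rule payoff_difference_tendsto_0[OF i Z f])
      fix t assume t: "t \<in> space (PiM I T)"
      have "(\<lambda>n. u i (prof (Z n) t) (t i)) \<longlonglongrightarrow> u i (prof f t) (t i)"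
      proof (rule u_tendsto[OF i player_type_in_space[OF i t]])
        show "prof (Z k) t \<in> PiE I A" "prof f t \<in> PiE I A" for k
          using prof_in_A[OF _ t] Z f by blast+
        show "(\<lambda>k. prof (Z k) t j) \<longlonglongrightarrow> prof f t j" if "j \<in> I" for j
          using lim[OF that player_type_in_space[OF that t]] that by simp
      qed
      then show "(\<lambda>n. u i (prof (Z n) t) (t i) - u i (prof f t) (t i)) \<longlonglongrightarrow> 0" by (simp add: LIM_zero)
    qed
    then show ?thesis by (rule LIM_zero_cancel)
  qed
  \<comment> \<open>Uniformity in \<open>k\<close> comes by contradiction: a violating choice of
    \<open>n N \<ge> N\<close> and \<open>k N\<close> would contradict
    \<open>uniform_discretization\<close>, which allows arbitrary profiles along the
    sequence.\<close>
  have unif: "\<exists>N. \<forall>n\<ge>N. \<forall>k. \<bar>pay i (Y k) - pay i (Y' n k)\<bar> < e" if "e > 0" for e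
  proof (rule ccontr)
    assume "\<not> ?thesis"
    then have "\<forall>N. \<exists>n k. n \<ge> N \<and> \<not> \<bar>pay i (Y k) - pay i (Y' n k)\<bar> < e" by auto
    then obtain n k where nk: "\<And>N. n N \<ge> N" "\<And>N. \<not> \<bar>pay i (Y (k N)) - pay i (Y' (n N) (k N))\<bar> < e" by metis
    have n: "filterlim n at_top sequentially"
      using filterlim_at_top_mono[OF filterlim_ident[of sequentially]] nk(1) by simp
    have "(\<lambda>N. pay i (Y (k N)) - pay i (Y' (n N) (k N))) \<longlonglongrightarrow> 0"
    proof (rule payoff_difference_tendsto_0[OF i Y Y'])
      fix t assume t: "t \<in> space (PiM I T)"
      have eq: "(\<lambda>j\<in>I. \<rho> j (n N) (prof (Y (k N)) t j)) = prof (Y' (n N) (k N)) t" for N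
        by (rule restrict_ext) (simp add: Y'_def)
      have "(\<lambda>N. u i (prof (Y (k N)) t) (t i) - u i (\<lambda>j\<in>I. \<rho> j (n N) (prof (Y (k N)) t j)) (t i)) \<longlonglongrightarrow> 0"
        using prof_in_A[OF Y t] by (intro uniform_discretization[OF i player_type_in_space[OF i t] _ n])
      then show "(\<lambda>N. u i (prof (Y (k N)) t) (t i) - u i (prof (Y' (n N) (k N)) t) (t i)) \<longlonglongrightarrow> 0"
        by (simp only: eq)
    qed
    from LIMSEQ_D[OF this \<open>e > 0\<close>] nk(2) show False by auto
  qed
  show ?thesis
  proof (rule LIMSEQ_I)
    fix e :: real assume e: "e > 0"
    obtain N where N: "\<And>n k. n \<ge> N \<Longrightarrow> \<bar>pay i (Y k) - pay i (Y' n k)\<bar> < e / 3"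
      using unif[of "e/3"] e by auto
    obtain N' where N': "\<And>n. n \<ge> N' \<Longrightarrow> \<bar>pay i (Z n) - pay i f\<bar> < e / 3"
      using LIMSEQ_D[OF Zf, of "e/3"] e by (auto simp: real_norm_def)
    define n where "n = max N N'"
    obtain K where K: "\<And>k. k \<ge> K \<Longrightarrow> \<bar>pay i (Y' n k) - pay i (Z n)\<bar> < e / 3"
      using LIMSEQ_D[OF level[of n], of "e/3"] e by (auto simp: real_norm_def)
    have "\<bar>pay i (Y k) - pay i f\<bar> < e" if "k \<ge> K" for k
    proof -
      have "n \<ge> N" "n \<ge> N'" by (simp_all add: n_def)
      from N[OF this(1), of k] N'[OF this(2)] K[OF that] show ?thesis by linarith
    qed
    then show "\<exists>K. \<forall>k\<ge>K. norm (pay i (Y k) - pay i f) < e" by (auto simp: real_norm_def)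
  qed
qed

end

context incomplete_information_game
begin

lemma sum_choice_events:
  assumes "finite S" "G \<in> sets (T j)" "\<And>s. s \<in> S \<Longrightarrow> choice_event j g s \<in> sets (T j)"
  shows "(\<Sum>s\<in>S. measure (T j) (choice_event j g s \<inter> G)) = measure (T j) (space (T j) \<inter> g -` S \<inter> G)"
proof -
  have "space (T j) \<inter> g -` S \<inter> G = (\<Union>s\<in>S. choice_event j g s \<inter> G)" by (auto simp: choice_event_def)
  also have "measure (T j) \<dots> = (\<Sum>s\<in>S. measure (T j) (choice_event j g s \<inter> G))"
    using assms by (intro info.finite_measure_finite_Union) (auto simp: disjoint_family_on_def choice_event_def)
  finally show ?thesis by simp
qed

text \<open>Compactness of profiles of pure strategies with respect to the conditional laws of
  the discretized actions given \<open>F j\<close>.\<close>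

lemma limit_profile:
  assumes Y: "\<And>k j. j \<in> I \<Longrightarrow> Y k j \<in> strat j"
  obtains r f Z where "strict_mono (r :: nat \<Rightarrow> nat)" "\<And>j. j \<in> I \<Longrightarrow> f j \<in> strat j"
    "\<And>n j. j \<in> I \<Longrightarrow> Z n j \<in> strat j"
    "\<And>n j t. j \<in> I \<Longrightarrow> t \<in> space (T j) \<Longrightarrow> Z n j t \<in> \<rho> j n ` A j"
    "\<And>j n s G. j \<in> I \<Longrightarrow> s \<in> \<rho> j n ` A j \<Longrightarrow> G \<in> sets (F j) \<Longrightarrow>
      (\<lambda>k. measure (T j) (choice_event j (\<lambda>t. \<rho> j n (Y (r k) j t)) s \<inter> G)) \<longlonglongrightarrow>
      measure (T j) (choice_event j (Z n j) s \<inter> G)"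
    "\<And>j t. j \<in> I \<Longrightarrow> t \<in> space (T j) \<Longrightarrow> (\<lambda>n. Z n j t) \<longlonglongrightarrow> f j t"
proof -
  have "\<exists>\<G>. countable \<G> \<and> Int_stable \<G> \<and> \<G> \<subseteq> Pow (space (T j)) \<and> space (T j) \<in> \<G> \<and>
      sets (F j) = sigma_sets (space (T j)) \<G>" for j
    using countable_Int_stable_generator[OF F_countably_generated[of j]] by (metis info.space_F)
  then obtain \<G> where \<G>: "\<And>j. countable (\<G> j)" "\<And>j. Int_stable (\<G> j)" "\<And>j. \<G> j \<subseteq> Pow (space (T j))"
    "\<And>j. space (T j) \<in> \<G> j" "\<And>j. sets (F j) = sigma_sets (space (T j)) (\<G> j)" by metis
  define E where "E j n k s = choice_event j (\<lambda>t. \<rho> j n (Y k j t)) s" for j n k s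
  have EM: "E j n k s \<in> sets (T j)" if "j \<in> I" for j n k s
    unfolding E_def using choice_event_measurable[OF \<rho>_strat[OF that Y[OF that]]] .
  \<comment> \<open>One coordinate for each player, level, cell and generating set: countably many
    numbers in [0,1] determine all conditional laws at all levels.\<close>
  let ?J = "SIGMA j:I. SIGMA n:UNIV. SIGMA s:\<rho> j n ` A j. \<G> j"
  have J: "countable ?J"
    using finite_I \<rho>_finite \<G>(1) by (intro countable_SIGMA) (auto intro: countable_finite)
  have 01: "(case p of (j, n, s, G) \<Rightarrow> measure (T j) (E j n k s \<inter> G)) \<in> {0..1}" for p k
    by (auto split: prod.split)
  obtain r l where r: "strict_mono r" and
    l: "\<And>p. p \<in> ?J \<Longrightarrow> l p \<in> {0..1} \<and> (\<lambda>k. case p of (j, n, s, G) \<Rightarrow> measure (T j) (E j n (r k) s \<inter> G)) \<longlonglongrightarrow> l p"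
    using countable_family_convergent_subsequence[OF J, of "\<lambda>_. {0..1::real}"
        "\<lambda>k p. case p of (j, n, s, G) \<Rightarrow> measure (T j) (E j n k s \<inter> G)", OF compact_Icc 01] by blast
  have conv: "convergent (\<lambda>k. measure (T j) (E j n (r k) s \<inter> G))"
    if j: "j \<in> I" "s \<in> \<rho> j n ` A j" "G \<in> sets (F j)" for j n s G
  proof (rule info.convergent_prob_Int[OF EM[OF j(1)] \<G>(2-5) _ j(3)])
    fix G assume "G \<in> \<G> j"
    then have "(j, n, s, G) \<in> ?J" using j by auto
    from l[OF this] show "convergent (\<lambda>k. measure (T j) (E j n (r k) s \<inter> G))" by (auto simp: convergent_def)
  qed
  define \<nu> where "\<nu> j n s G = Lim sequentially (\<lambda>k. measure (T j) (E j n (r k) s \<inter> G))" for j n s G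
  have \<nu>: "(\<lambda>k. measure (T j) (E j n (r k) s \<inter> G)) \<longlonglongrightarrow> \<nu> j n s G"
    if "j \<in> I" "s \<in> \<rho> j n ` A j" "G \<in> sets (F j)" for j n s G
    using conv[OF that] by (simp add: \<nu>_def convergent_LIMSEQ_iff)
  define D where "D j n s q \<longleftrightarrow> q \<in> borel_measurable (F j) \<and> integrable (T j) q \<and> (\<forall>x. q x \<ge> 0) \<and>
      (\<forall>G\<in>sets (F j). (\<integral>x\<in>G. q x \<partial>T j) = \<nu> j n s G)" for j n s and q :: "'t \<Rightarrow> real"
  define q where "q j n s = (SOME q. D j n s q)" for j n s
  have D: "D j n s (q j n s)" if js: "j \<in> I" "s \<in> \<rho> j n ` A j" for j n s
  proof -
    obtain q where "q \<in> borel_measurable (F j)" "integrable (T j) q" "\<And>x. q x \<ge> 0"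
      "\<And>G. G \<in> sets (F j) \<Longrightarrow> (\<integral>x\<in>G. q x \<partial>T j) = \<nu> j n s G"
      using info.limit_density[OF EM[OF js(1)] \<nu>[OF js]] by blast
    then have "D j n s q" by (auto simp: D_def)
    then show ?thesis unfolding q_def by (rule someI[of "D j n s"])
  qed
  have q: "q j n s \<in> borel_measurable (F j) \<and> integrable (T j) (q j n s) \<and> (\<forall>x\<in>space (T j). q j n s x \<ge> 0)"
    and q\<nu>: "\<And>G. G \<in> sets (F j) \<Longrightarrow> (\<integral>x\<in>G. q j n s x \<partial>T j) = \<nu> j n s G"
    if "j \<in> I" "s \<in> \<rho> j n ` A j" for j n s
    using D[OF that] by (auto simp: D_def)
  have tree: "\<exists>Z. (\<forall>n x. Z n x \<in> \<rho> j n ` A j) \<and> (\<forall>n x. \<rho> j n (Z (Suc n) x) = Z n x) \<and>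
    (\<forall>n. \<forall>s\<in>\<rho> j n ` A j. space (T j) \<inter> Z n -` {s} \<in> sets (T j) \<and>
      (\<forall>G\<in>sets (F j). measure (T j) (space (T j) \<inter> Z n -` {s} \<inter> G) = \<nu> j n s G))"
    if j: "j \<in> I" for j
  proof -
    have YA: "Y k j t \<in> A j" if "t \<in> space (T j)" for k t using strat_in_A[OF Y[OF j] that] .
    obtain Z where Z: "\<And>n x. Z n x \<in> \<rho> j n ` A j" "\<And>n x. \<rho> j n (Z (Suc n) x) = Z n x"
      "\<And>n s. s \<in> \<rho> j n ` A j \<Longrightarrow> space (T j) \<inter> Z n -` {s} \<in> sets (T j)"
      "\<And>n s G. s \<in> \<rho> j n ` A j \<Longrightarrow> G \<in> sets (F j) \<Longrightarrow>
        measure (T j) (space (T j) \<inter> Z n -` {s} \<inter> G) = (\<integral>x\<in>G. q j n s x \<partial>T j)"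
    proof (rule info.tree_with_conditional_probabilities[of "\<lambda>n. \<rho> j n ` A j" "\<lambda>n. \<rho> j n" "\<lambda>n. q j n" j])
      show "finite (\<rho> j n ` A j)" for n by (rule \<rho>_finite[OF j])
      show "\<rho> j 0 ` A j \<noteq> {}" using A_nonempty[OF j] by simp
      show "\<exists>s'\<in>\<rho> j (Suc n) ` A j. \<rho> j n s' = s" if s: "s \<in> \<rho> j n ` A j" for n s
      proof -
        obtain a where "a \<in> A j" "s = \<rho> j n a" using s by blast
        then show ?thesis using \<rho>_\<rho>[OF j le_SucI[OF order_refl]] by (intro bexI[of _ "\<rho> j (Suc n) a"]) auto
      qed
      show "\<rho> j n s \<in> \<rho> j n ` A j" if "s \<in> \<rho> j (Suc n) ` A j" for n s
        using that \<rho>_in_A[OF j] by blast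
      show "q j n s \<in> borel_measurable (F j) \<and> integrable (T j) (q j n s) \<and> (\<forall>x\<in>space (T j). 0 \<le> q j n s x)"
        if "s \<in> \<rho> j n ` A j" for n s using q[OF j that] .
      show "(\<Sum>s\<in>\<rho> j 0 ` A j. \<integral>x\<in>G. q j 0 s x \<partial>T j) = measure (T j) G" if G: "G \<in> sets (F j)" for G
      proof -
        \<comment> \<open>Before the limit the events of level 0 partition the type space, so the
          sums are constant in \<open>k\<close>; the finite sum of the limits inherits the
          value.\<close>
        have "(\<Sum>s\<in>\<rho> j 0 ` A j. measure (T j) (E j 0 (r k) s \<inter> G)) = measure (T j) G" for k
        proof -
          have "space (T j) \<inter> (\<lambda>t. \<rho> j 0 (Y (r k) j t)) -` (\<rho> j 0 ` A j) \<inter> G = G"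
            using YA sets.sets_into_space[OF info.F_in_sets[OF G]] by auto
          then show ?thesis
            unfolding E_def
            using sum_choice_events[OF \<rho>_finite[OF j, of 0] info.F_in_sets[OF G] EM[OF j, of 0 "r k", unfolded E_def]] by simp
        qed
        moreover have "(\<lambda>k. \<Sum>s\<in>\<rho> j 0 ` A j. measure (T j) (E j 0 (r k) s \<inter> G)) \<longlonglongrightarrow> (\<Sum>s\<in>\<rho> j 0 ` A j. \<nu> j 0 s G)"
          using \<nu>[OF j _ G] by (intro tendsto_sum)
        ultimately show ?thesis using q\<nu>[OF j _ G] by (simp add: LIMSEQ_const_iff)
      qed
      show "(\<Sum>s'\<in>{s'\<in>\<rho> j (Suc n) ` A j. \<rho> j n s' = s}. \<integral>x\<in>G. q j (Suc n) s' x \<partial>T j) = (\<integral>x\<in>G. q j n s x \<partial>T j)"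
        if s: "s \<in> \<rho> j n ` A j" and G: "G \<in> sets (F j)" for n s G
      proof -
        let ?S = "{s'\<in>\<rho> j (Suc n) ` A j. \<rho> j n s' = s}"
        have fin: "finite ?S" using \<rho>_finite[OF j] by simp
        have "(\<Sum>s'\<in>?S. measure (T j) (E j (Suc n) (r k) s' \<inter> G)) = measure (T j) (E j n (r k) s \<inter> G)" for k
        proof -
          \<comment> \<open>By the composition law of the discretizations, the events of the
            children of \<open>s\<close> partition the event of \<open>s\<close>. The additivity of
            the limits over children follows.\<close>
          have "space (T j) \<inter> (\<lambda>t. \<rho> j (Suc n) (Y (r k) j t)) -` ?S \<inter> G = E j n (r k) s \<inter> G"
          proof -
            have "\<rho> j (Suc n) (Y (r k) j t) \<in> ?S \<longleftrightarrow> \<rho> j n (Y (r k) j t) = s" if "t \<in> space (T j)" for t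
              using YA[OF that, of "r k"] \<rho>_\<rho>[OF j, of n "Suc n"] by simp
            then show ?thesis by (auto simp: E_def choice_event_def)
          qed
          then show ?thesis
            unfolding E_def
            using sum_choice_events[OF fin info.F_in_sets[OF G] EM[OF j, of "Suc n" "r k", unfolded E_def]] by simp
        qed
        moreover have "(\<lambda>k. \<Sum>s'\<in>?S. measure (T j) (E j (Suc n) (r k) s' \<inter> G)) \<longlonglongrightarrow> (\<Sum>s'\<in>?S. \<nu> j (Suc n) s' G)"
          using \<nu>[OF j _ G] by (intro tendsto_sum) auto
        ultimately have "(\<Sum>s'\<in>?S. \<nu> j (Suc n) s' G) = \<nu> j n s G"
          using \<nu>[OF j s G] by (simp add: LIMSEQ_unique)
        then show ?thesis using q\<nu>[OF j _ G] s by simp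
      qed
    qed (rule that, blast+)
    then show ?thesis using q\<nu>[OF j] by (intro exI[of _ Z]) auto
  qed
  define Pr where "Pr j Z \<longleftrightarrow> (\<forall>n x. Z n x \<in> \<rho> j n ` A j) \<and> (\<forall>n x. \<rho> j n (Z (Suc n) x) = Z n x) \<and>
    (\<forall>n. \<forall>s\<in>\<rho> j n ` A j. space (T j) \<inter> Z n -` {s} \<in> sets (T j) \<and>
      (\<forall>G\<in>sets (F j). measure (T j) (space (T j) \<inter> Z n -` {s} \<inter> G) = \<nu> j n s G))" for j Z
  have "\<forall>j\<in>I. \<exists>Z. Pr j Z" using tree by (simp add: Pr_def)
  then obtain Z' where Z': "\<And>j. j \<in> I \<Longrightarrow> Pr j (Z' j)" by metis
  define Z where "Z n j = Z' j n" for n j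
  have ZX: "Z n j x \<in> \<rho> j n ` A j" and Z\<rho>: "\<rho> j n (Z (Suc n) j x) = Z n j x" if "j \<in> I" for n j x
    using Z'[OF that] by (auto simp: Pr_def Z_def)
  have ZM: "choice_event j (Z n j) s \<in> sets (T j)"
    and Z\<nu>: "G \<in> sets (F j) \<Longrightarrow> measure (T j) (choice_event j (Z n j) s \<inter> G) = \<nu> j n s G"
    if "j \<in> I" "s \<in> \<rho> j n ` A j" for n j s G
    using Z'[OF that(1)] that(2) by (auto simp: Pr_def Z_def choice_event_def)
  have ZA: "Z n j x \<in> A j" if "j \<in> I" for n j x
  proof -
    obtain a where "a \<in> A j" "Z n j x = \<rho> j n a" using ZX[OF \<open>j \<in> I\<close>, of n x] by (rule imageE)
    then show ?thesis using \<rho>_in_A[OF \<open>j \<in> I\<close>] by simp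
  qed
  have Zstrat: "Z n j \<in> strat j" if "j \<in> I" for n j
    by (rule finite_valued_strat[OF \<rho>_finite[OF that]]) (use ZX[OF that] ZM[OF that] \<rho>_in_A[OF that] in auto)
  have Zmn: "\<rho> j n (Z m j x) = Z n j x" if "j \<in> I" "n < m" for j n m x
    using that(2)
  proof (induction m)
    case (Suc m)
    show ?case
    proof (cases "n = m")
      case False
      then have "n < m" using Suc.prems by simp
      have "\<rho> j n (Z (Suc m) j x) = \<rho> j n (\<rho> j m (Z (Suc m) j x))"
        using \<rho>_\<rho>[OF \<open>j \<in> I\<close>, of n m] \<open>n < m\<close> ZA[OF \<open>j \<in> I\<close>] by simp
      then show ?thesis using Suc.IH \<open>n < m\<close> Z\<rho>[OF \<open>j \<in> I\<close>] by simp
    qed (simp add: Z\<rho>[OF \<open>j \<in> I\<close>])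
  qed simp
  have "\<exists>a\<in>A j. (\<lambda>n. Z n j x) \<longlonglongrightarrow> a" if j: "j \<in> I" for j x
  proof -
    \<comment> \<open>For \<open>n < m\<close>, \<open>Z n j x\<close> is the level-\<open>n\<close>
      discretization of \<open>Z m j x\<close>, so their distance is bounded by the mesh at level
      \<open>n\<close>. This is where coherence along the tree pays off.\<close>
    have "Cauchy (\<lambda>n. Z n j x)"
    proof (rule CauchyI')
      fix e :: real assume "e > 0"
      then obtain N where "\<And>n a. n \<ge> N \<Longrightarrow> a \<in> A j \<Longrightarrow> dist (\<rho> j n a) a < e" using \<rho>_close[OF j] by blast
      then have "dist (Z n j x) (Z m j x) < e" if "n \<ge> N" "n < m" for n m
        using Zmn[OF j that(2)] that(1) ZA[OF j] by metis
      then show "\<exists>N. \<forall>m\<ge>N. \<forall>n>m. dist (Z m j x) (Z n j x) < e" by blast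
    qed
    then show ?thesis
      using compact_imp_complete[OF A_compact[OF j]] ZA[OF j] by (auto simp: complete_def)
  qed
  then obtain f where f: "\<And>j x. j \<in> I \<Longrightarrow> f j x \<in> A j \<and> (\<lambda>n. Z n j x) \<longlonglongrightarrow> f j x" by metis
  have fstrat: "f j \<in> strat j" if j: "j \<in> I" for j
  proof -
    have fA: "f j \<in> space (T j) \<rightarrow> A j" using f[OF j] by blast
    have ZB: "Z n j \<in> borel_measurable (T j)" for n
      using Zstrat[OF j, of n] by (simp add: pure_strategies_def action_space_def measurable_restrict_space2_iff)
    have "f j \<in> borel_measurable (T j)"
    proof (rule borel_measurable_LIMSEQ_metric[where f="\<lambda>n. Z n j" and g="f j"])
      show "(\<lambda>n. Z n j t) \<longlonglongrightarrow> f j t" for t using f[OF j, of t] by (rule conjunct2)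
    qed (rule ZB)
    with fA show ?thesis
      by (simp add: pure_strategies_def action_space_def measurable_restrict_space2_iff)
  qed
  show ?thesis
  proof (rule that[OF r fstrat Zstrat])
    show "(\<lambda>k. measure (T j) (choice_event j (\<lambda>t. \<rho> j n (Y (r k) j t)) s \<inter> G)) \<longlonglongrightarrow>
      measure (T j) (choice_event j (Z n j) s \<inter> G)" if "j \<in> I" "s \<in> \<rho> j n ` A j" "G \<in> sets (F j)" for j n s G
      using \<nu>[OF that] Z\<nu>[OF that] by (simp add: E_def)
    show "Z n j t \<in> \<rho> j n ` A j" if "j \<in> I" for n j t using ZX[OF that] .
    show "(\<lambda>n. Z n j t) \<longlonglongrightarrow> f j t" if "j \<in> I" for j t using f[OF that] by blast
  qed
qed

end

section \<open>Approximate equilibria of the discretized games\<close>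

context incomplete_information_game
begin

text \<open>The expected payoff of player \<open>i\<close> from action \<open>s\<close> when opponent \<open>j\<close> plays \<open>b\<close> with
  probability \<open>x (j, b)\<close>.\<close>

definition interim :: "('i \<Rightarrow> 'a set) \<Rightarrow> 'i \<Rightarrow> 't \<Rightarrow> ('i \<times> 'a \<Rightarrow> real) \<Rightarrow> 'a \<Rightarrow> real" where
  "interim X i t x s = (\<Sum>b\<in>PiE (I - {i}) X. (\<Prod>j\<in>I - {i}. x (j, b j)) * u i (b(i := s)) t)"

lemma fun_upd_in_A:
  assumes i: "i \<in> I" and X: "\<And>j. j \<in> I \<Longrightarrow> X j \<subseteq> A j" and "b \<in> PiE (I - {i}) X" "s \<in> X i"
  shows "b(i := s) \<in> PiE I A"
proof -
  have "b(i := s) \<in> PiE (insert i (I - {i})) X" using assms(3,4) by (intro PiE_fun_upd)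
  moreover have "insert i (I - {i}) = I" using i by auto
  ultimately show ?thesis using PiE_mono[of I X A] X by auto
qed

lemma interim_measurable_integrable:
  assumes "i \<in> I" "\<And>j. j \<in> I \<Longrightarrow> X j \<subseteq> A j" "s \<in> X i"
  shows "(\<lambda>t. interim X i t x s) \<in> borel_measurable (F i)" "integrable (T i) (\<lambda>t. interim X i t x s)"
proof -
  have upd: "b(i := s) \<in> PiE I A" if "b \<in> PiE (I - {i}) X" for b
    using fun_upd_in_A[OF assms(1,2) that assms(3)] .
  show "(\<lambda>t. interim X i t x s) \<in> borel_measurable (F i)"
    unfolding interim_def
    by (intro borel_measurable_sum borel_measurable_times borel_measurable_const
        u_component_measurable[OF assms(1)] upd)
  show "integrable (T i) (\<lambda>t. interim X i t x s)"
    unfolding interim_def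
    by (intro Bochner_Integration.integrable_sum integrable_mult_right u_component_integrable[OF assms(1)] upd)
qed

text \<open>The sum over action profiles is split into the own action and those of the opponents.
  The numbers \<open>x\<close> are tied to \<open>Y\<close> for opponents only, so one and the same
  \<open>x\<close> serves a profile and every unilateral deviation of \<open>i\<close> from
  it.\<close>

lemma payoff_interim:
  assumes i: "i \<in> I" and X: "\<And>j. j \<in> I \<Longrightarrow> finite (X j)" "\<And>j. j \<in> I \<Longrightarrow> X j \<subseteq> A j"
    and Y: "\<And>j. j \<in> I \<Longrightarrow> Y j \<in> strat j" "\<And>j t. j \<in> I \<Longrightarrow> t \<in> space (T j) \<Longrightarrow> Y j t \<in> X j"
    and x: "\<And>j s. j \<in> I - {i} \<Longrightarrow> s \<in> X j \<Longrightarrow> x (j, s) = measure (T j) (choice_event j (Y j) s)"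
  shows "pay i Y = (\<Sum>s\<in>X i. \<integral>t. indicator (choice_event i (Y i) s) t * interim X i t x s \<partial>T i)"
proof -
  let ?B = "PiE (I - {i}) X" and ?ind = "\<lambda>s. indicator (choice_event i (Y i) s)"
  let ?g = "\<lambda>b. (\<integral>t. ?ind (b i) t * u i b t \<partial>T i) * (\<Prod>j\<in>I - {i}. measure (T j) (choice_event j (Y j) (b j)))"
  have I: "insert i (I - {i}) = I" using i by auto
  have bij: "PiE I X = (\<lambda>(s, b). b(i := s)) ` (X i \<times> ?B)"
    using PiE_insert_eq[of i "I - {i}" X] unfolding I .
  have inj: "inj_on (\<lambda>(s, b). b(i := s)) (X i \<times> ?B)"
    by (rule inj_combinator) simp
  have int: "integrable (T i) (\<lambda>t. ?ind s t * u i (b(i := s)) t)" if "s \<in> X i" "b \<in> ?B" for s b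
    using integrable_mult_indicator[OF choice_event_measurable[OF Y(1)[OF i]]
        u_component_integrable[OF i fun_upd_in_A[OF i X(2) that(2,1)]]] by simp
  have "pay i Y = sum ?g (PiE I X)" by (rule payoff_finite_valued[OF i X Y])
  also have "\<dots> = (\<Sum>(s, b)\<in>X i \<times> ?B. ?g (b(i := s)))"
    unfolding bij using sum.reindex[OF inj, of ?g] by (simp add: o_def case_prod_unfold)
  also have "\<dots> = (\<Sum>s\<in>X i. \<Sum>b\<in>?B. ?g (b(i := s)))" by (simp add: sum.cartesian_product)
  also have "\<dots> = (\<Sum>s\<in>X i. \<integral>t. ?ind s t * interim X i t x s \<partial>T i)"
  proof (rule sum.cong[OF refl])
    fix s assume s: "s \<in> X i"
    have "?g (b(i := s)) = (\<integral>t. (\<Prod>j\<in>I - {i}. x (j, b j)) * (?ind s t * u i (b(i := s)) t) \<partial>T i)"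
      if b: "b \<in> ?B" for b
    proof -
      have "(\<Prod>j\<in>I - {i}. measure (T j) (choice_event j (Y j) ((b(i := s)) j))) = (\<Prod>j\<in>I - {i}. x (j, b j))"
        using x b by (intro prod.cong) (auto simp: PiE_iff)
      then show ?thesis by simp
    qed
    then have "(\<Sum>b\<in>?B. ?g (b(i := s))) = (\<Sum>b\<in>?B. \<integral>t. (\<Prod>j\<in>I - {i}. x (j, b j)) * (?ind s t * u i (b(i := s)) t) \<partial>T i)"
      by (rule sum.cong[OF refl])
    also have "\<dots> = (\<integral>t. (\<Sum>b\<in>?B. (\<Prod>j\<in>I - {i}. x (j, b j)) * (?ind s t * u i (b(i := s)) t)) \<partial>T i)"
      using int[OF s] by (intro Bochner_Integration.integral_sum[symmetric] integrable_mult_right)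
    also have "\<dots> = (\<integral>t. ?ind s t * interim X i t x s \<partial>T i)"
      by (simp add: interim_def sum_distrib_left mult.left_commute)
    finally show "(\<Sum>b\<in>?B. ?g (b(i := s))) = (\<integral>t. ?ind s t * interim X i t x s \<partial>T i)" .
  qed
  finally show ?thesis .
qed

text \<open>A fixed point of the laws of the smoothed best replies, purified player by player.\<close>

lemma finite_game_approximate_equilibrium:
  assumes X: "\<And>j. j \<in> I \<Longrightarrow> finite (X j)" "\<And>j. j \<in> I \<Longrightarrow> X j \<subseteq> A j" "\<And>j. j \<in> I \<Longrightarrow> X j \<noteq> {}"
    and \<epsilon>: "\<epsilon> > 0"
  obtains Y where "\<And>j. j \<in> I \<Longrightarrow> Y j \<in> strat j"
    "\<And>i g. i \<in> I \<Longrightarrow> g \<in> strat i \<Longrightarrow> (\<And>t. t \<in> space (T i) \<Longrightarrow> g t \<in> X i) \<Longrightarrow> pay i (Y(i := g)) \<le> pay i Y + \<epsilon>"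
proof -
  let ?J = "SIGMA i:I. X i"
  define m where "m x i s t = soft_max \<epsilon> (X i) (interim X i t x) s" for x i s t
  have mF: "m x i s \<in> borel_measurable (F i)" if "i \<in> I" "s \<in> X i" for x i s
    unfolding m_def[abs_def] using that X
    by (intro soft_max_measurable interim_measurable_integrable(1)) auto
  have m0: "m x i s t \<ge> 0" for x i s t unfolding m_def by (rule soft_max_nonneg)
  have m1: "m x i s t \<le> 1" if "i \<in> I" "s \<in> X i" for x i s t
    unfolding m_def using that X \<epsilon> by (intro soft_max_le_1) auto
  have msum: "(\<Sum>s\<in>X i. m x i s t) = 1" if "i \<in> I" for x i t
    unfolding m_def using that X \<epsilon> by (intro sum_soft_max) auto
  have mint: "integrable (T i) (m x i s)" if "i \<in> I" "s \<in> X i" for x i s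
    by (rule info.integrable_const_bound[where B=1]) (use m0 m1[OF that] mF[OF that] in auto)
  define \<Phi> where "\<Phi> x p = (\<integral>t. m x (fst p) (snd p) t \<partial>T (fst p))" for x p
  \<comment> \<open>Brouwer's theorem is used on the whole cube instead of a product of simplices:
    the soft maximum is defined for arbitrary \<open>x\<close>, and \<open>\<Phi> x\<close> always
    consists of probability vectors, so a fixed point is a profile of laws.\<close>
  obtain x where x: "x \<in> ?J \<rightarrow> {0..1}" "\<And>p. p \<in> ?J \<Longrightarrow> \<Phi> x p = x p"
  proof (rule brouwer_finite_cube[of ?J \<Phi>])
    show "finite ?J" using finite_I X(1) by auto
    fix x p assume "x \<in> ?J \<rightarrow> {0..1::real}" and p: "p \<in> ?J"
    then obtain i s where ps: "p = (i, s)" "i \<in> I" "s \<in> X i" by auto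
    have "(\<integral>t. m x i s t \<partial>T i) \<ge> 0" using m0 by (intro integral_nonneg_AE) auto
    moreover have "(\<integral>t. m x i s t \<partial>T i) \<le> (\<integral>t. 1 \<partial>T i)"
      using m1[OF ps(2,3)] by (intro integral_mono mint ps(2,3)) auto
    ultimately show "\<Phi> x p \<in> {0..1}" by (simp add: \<Phi>_def ps(1) info.prob_space)
  next
    fix Z :: "nat \<Rightarrow> 'i \<times> 'a \<Rightarrow> real" and x p
    assume lim: "\<And>p. p \<in> ?J \<Longrightarrow> (\<lambda>n. Z n p) \<longlonglongrightarrow> x p" and p: "p \<in> ?J"
    then obtain i s where ps: "p = (i, s)" "i \<in> I" "s \<in> X i" by auto
    have "(\<lambda>n. m (Z n) i s t) \<longlonglongrightarrow> m x i s t" for t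
      unfolding m_def
    proof (rule soft_max_tendsto[OF X(1)[OF ps(2)] \<epsilon> ps(3)])
      show "(\<lambda>k. interim X i t (Z k) c) \<longlonglongrightarrow> interim X i t x c" for c
        unfolding interim_def
      proof (intro tendsto_sum tendsto_mult tendsto_const tendsto_prod)
        fix b j assume "b \<in> PiE (I - {i}) X" "j \<in> I - {i}"
        then have "(j, b j) \<in> ?J" by (auto simp: PiE_iff)
        then show "(\<lambda>k. Z k (j, b j)) \<longlonglongrightarrow> x (j, b j)" by (rule lim)
      qed
    qed
    then have "(\<lambda>n. \<integral>t. m (Z n) i s t \<partial>T i) \<longlonglongrightarrow> (\<integral>t. m x i s t \<partial>T i)"
      using m0 m1[OF ps(2,3)] info.F_measurable[OF mF[OF ps(2,3)]]
      by (intro integral_dominated_convergence[where w="\<lambda>_. 1"]) auto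
    then show "(\<lambda>n. \<Phi> (Z n) p) \<longlonglongrightarrow> \<Phi> x p" by (simp add: \<Phi>_def ps(1))
  qed blast
  \<comment> \<open>\<open>Y\<close> is a purification of the smoothed best reply to
    \<open>x\<close>: its conditional law given \<open>F i\<close> has the weights
    \<open>m x i s\<close>.\<close>
  define Pr where "Pr i Y \<longleftrightarrow> (\<forall>t. Y t \<in> X i) \<and> (\<forall>s\<in>X i. space (T i) \<inter> Y -` {s} \<in> sets (T i) \<and>
      (\<forall>G\<in>sets (F i). measure (T i) (space (T i) \<inter> Y -` {s} \<inter> G) = (\<integral>t\<in>G. m x i s t \<partial>T i)))" for i Y
  have "\<forall>i\<in>I. \<exists>Y. Pr i Y"
  proof
    fix i assume i: "i \<in> I"
    show "\<exists>Y. Pr i Y"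
      unfolding Pr_def
    proof (rule info.finite_partition_with_conditional_probabilities[OF X(1)[OF i] X(3)[OF i] sets.top])
      show "m x i s \<in> borel_measurable (F i) \<and> integrable (T i) (m x i s) \<and> (\<forall>t\<in>space (T i). 0 \<le> m x i s t)"
        if "s \<in> X i" for s using mF[OF i that] mint[OF i that] m0 by auto
      fix G assume G: "G \<in> sets (F i)"
      have GT: "G \<in> sets (T i)" using G by (rule info.F_in_sets)
      have "(\<Sum>s\<in>X i. \<integral>t\<in>G. m x i s t \<partial>T i) = (\<integral>t. (\<Sum>s\<in>X i. indicator G t * m x i s t) \<partial>T i)"
        using integrable_mult_indicator[OF GT mint[OF i]]
        by (simp add: set_lebesgue_integral_def Bochner_Integration.integral_sum)
      also have "\<dots> = (\<integral>t. indicator G t \<partial>T i)"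
        using msum[OF i] by (simp add: sum_distrib_left[symmetric])
      also have "\<dots> = measure (T i) (space (T i) \<inter> G)" using GT by (simp add: Int_commute)
      finally show "(\<Sum>s\<in>X i. \<integral>t\<in>G. m x i s t \<partial>T i) = measure (T i) (space (T i) \<inter> G)" .
    qed
  qed
  then obtain Y where Y: "\<And>i. i \<in> I \<Longrightarrow> Pr i (Y i)" by metis
  have YX: "Y i t \<in> X i" if "i \<in> I" for i t using Y[OF that] by (simp add: Pr_def)
  have YM: "choice_event i (Y i) s \<in> sets (T i)"
    and YG: "\<And>G. G \<in> sets (F i) \<Longrightarrow> measure (T i) (choice_event i (Y i) s \<inter> G) = (\<integral>t\<in>G. m x i s t \<partial>T i)"
    if "i \<in> I" "s \<in> X i" for i s
    using Y[OF that(1)] that(2) by (auto simp: Pr_def choice_event_def)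
  have Ystrat: "Y i \<in> strat i" if "i \<in> I" for i
    using X[OF that] YX[OF that] YM[OF that] by (intro finite_valued_strat[of "X i"]) auto
  \<comment> \<open>With \<open>G\<close> the whole space, the purified strategies have the laws
    \<open>x\<close> to which they were smoothed replies.\<close>
  have law: "x (i, s) = measure (T i) (choice_event i (Y i) s)" if "i \<in> I" "s \<in> X i" for i s
  proof -
    have "choice_event i (Y i) s \<inter> space (T i) = choice_event i (Y i) s" by (auto simp: choice_event_def)
    moreover have "(\<integral>t\<in>space (T i). m x i s t \<partial>T i) = (\<integral>t. m x i s t \<partial>T i)"
      using mint[OF that] by (rule set_integral_space)
    ultimately show ?thesis
      using YG[OF that sets.top] x(2)[of "(i, s)"] that by (simp add: \<Phi>_def)
  qed
  have "pay i (Y(i := g)) \<le> pay i Y + \<epsilon>"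
    if i: "i \<in> I" and g: "g \<in> strat i" and gX: "\<And>t. t \<in> space (T i) \<Longrightarrow> g t \<in> X i" for i g
  proof -
    let ?W = "\<lambda>s t. interim X i t x s"
    have W: "?W s \<in> borel_measurable (F i)" "integrable (T i) (?W s)" if "s \<in> X i" for s
      using interim_measurable_integrable[OF i X(2) that] by auto
    have gint: "integrable (T i) (\<lambda>t. indicator (choice_event i g s) t * ?W s t)" if "s \<in> X i" for s
      using integrable_mult_indicator[OF choice_event_measurable[OF g] W(2)[OF that]] by simp
    have mWint: "integrable (T i) (\<lambda>t. m x i s t * ?W s t)" if "s \<in> X i" for s
    proof (rule Bochner_Integration.integrable_bound[OF W(2)[OF that]])
      show "(\<lambda>t. m x i s t * ?W s t) \<in> borel_measurable (T i)"
        using W(1)[OF that] mF[OF i that] by (intro borel_measurable_times info.F_measurable)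
      show "AE t in T i. norm (m x i s t * ?W s t) \<le> norm (?W s t)"
        using m0 m1[OF i that] by (intro AE_I2) (simp add: abs_mult mult_left_le_one_le)
    qed
    have "pay i (Y(i := g)) = (\<Sum>s\<in>X i. \<integral>t. indicator (choice_event i g s) t * ?W s t \<partial>T i)"
    proof -
      have 1: "(Y(i := g)) j \<in> strat j" if "j \<in> I" for j using that Ystrat g by simp
      have 2: "(Y(i := g)) j t \<in> X j" if "j \<in> I" "t \<in> space (T j)" for j t using that YX gX by (cases "j = i") auto
      have 3: "x (j, s) = measure (T j) (choice_event j ((Y(i := g)) j) s)" if "j \<in> I - {i}" "s \<in> X j" for j s
        using that law by simp
      show ?thesis using payoff_interim[of i X "Y(i := g)" x, OF i X(1,2) 1 2 3] by simp
    qed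
    also have "\<dots> = (\<integral>t. (\<Sum>s\<in>X i. indicator (choice_event i g s) t * ?W s t) \<partial>T i)"
      using gint by (simp add: Bochner_Integration.integral_sum)
    also have "\<dots> \<le> (\<integral>t. (\<Sum>s\<in>X i. m x i s t * ?W s t) + \<epsilon> \<partial>T i)"
    proof (rule integral_mono)
      fix t assume t: "t \<in> space (T i)"
      have "(\<Sum>s\<in>X i. indicator (choice_event i g s) t * ?W s t) = (\<Sum>s\<in>X i. if g t = s then ?W s t else 0)"
        using t by (intro sum.cong) (auto simp: choice_event_def)
      also have "\<dots> = ?W (g t) t" using X(1)[OF i] gX[OF t] by simp
      also have "\<dots> \<le> (\<Sum>s\<in>X i. m x i s t * ?W s t) + \<epsilon>"
        unfolding m_def using X(1)[OF i] \<epsilon> gX[OF t] by (rule soft_max_optimal)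
      finally show "(\<Sum>s\<in>X i. indicator (choice_event i g s) t * ?W s t) \<le> (\<Sum>s\<in>X i. m x i s t * ?W s t) + \<epsilon>" .
    qed (use gint mWint in auto)
    also have "\<dots> = (\<Sum>s\<in>X i. \<integral>t. m x i s t * ?W s t \<partial>T i) + \<epsilon>"
      using mWint by (simp add: Bochner_Integration.integral_sum info.prob_space)
    \<comment> \<open>Equality of unconditional laws would not suffice here: the interim payoff
      varies with the type. It is \<open>F i\<close>-measurable, so equality of conditional laws
      does.\<close>
    also have "(\<Sum>s\<in>X i. \<integral>t. m x i s t * ?W s t \<partial>T i) = (\<Sum>s\<in>X i. \<integral>t. indicator (choice_event i (Y i) s) t * ?W s t \<partial>T i)"
    proof (rule sum.cong[OF refl])
      fix s assume s: "s \<in> X i"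
      show "(\<integral>t. m x i s t * ?W s t \<partial>T i) = (\<integral>t. indicator (choice_event i (Y i) s) t * ?W s t \<partial>T i)"
        using info.integral_indicator_eq_density[OF YM[OF i s] mF[OF i s] mint[OF i s] YG[OF i s] W[OF s]] by simp
    qed
    also have "\<dots> = pay i Y"
    proof -
      have "x (j, s) = measure (T j) (choice_event j (Y j) s)" if "j \<in> I - {i}" "s \<in> X j" for j s
        using that law by simp
      from payoff_interim[of i X Y x, OF i X(1,2) Ystrat YX this] show ?thesis by simp
    qed
    finally show ?thesis .
  qed
  then show ?thesis using that Ystrat by blast
qed

section \<open>Passage to the limit\<close>

theorem pure_equilibrium_exists: "\<exists>f. pure_equilibrium I A T (PiM I T) u f"
proof -
  have "\<exists>Y. (\<forall>j\<in>I. Y j \<in> strat j) \<and> (\<forall>i\<in>I. \<forall>g\<in>strat i. (\<forall>t\<in>space (T i). g t \<in> \<rho> i k ` A i) \<longrightarrow>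
      pay i (Y(i := g)) \<le> pay i Y + 1 / real (Suc k))" for k
  proof -
    obtain Y where "\<And>j. j \<in> I \<Longrightarrow> Y j \<in> strat j" "\<And>i g. i \<in> I \<Longrightarrow> g \<in> strat i \<Longrightarrow>
        (\<And>t. t \<in> space (T i) \<Longrightarrow> g t \<in> \<rho> i k ` A i) \<Longrightarrow> pay i (Y(i := g)) \<le> pay i Y + 1 / real (Suc k)"
    proof (rule finite_game_approximate_equilibrium[of "\<lambda>i. \<rho> i k ` A i" "1 / real (Suc k)"])
      show "\<rho> j k ` A j \<subseteq> A j" if "j \<in> I" for j using \<rho>_in_A[OF that] by blast
    qed (use \<rho>_finite A_nonempty in auto)
    then show ?thesis by blast
  qed
  then obtain Y where Y: "\<And>k j. j \<in> I \<Longrightarrow> Y k j \<in> strat j"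
    and eq: "\<And>k i g. i \<in> I \<Longrightarrow> g \<in> strat i \<Longrightarrow> \<forall>t\<in>space (T i). g t \<in> \<rho> i k ` A i \<Longrightarrow>
      pay i ((Y k)(i := g)) \<le> pay i (Y k) + 1 / real (Suc k)" by metis
  obtain r f Z where r: "strict_mono (r :: nat \<Rightarrow> nat)" and f: "\<And>j. j \<in> I \<Longrightarrow> f j \<in> strat j"
    and Z: "\<And>n j. j \<in> I \<Longrightarrow> Z n j \<in> strat j"
    and ZX: "\<And>n j t. j \<in> I \<Longrightarrow> t \<in> space (T j) \<Longrightarrow> Z n j t \<in> \<rho> j n ` A j"
    and conv: "\<And>j n s G. j \<in> I \<Longrightarrow> s \<in> \<rho> j n ` A j \<Longrightarrow> G \<in> sets (F j) \<Longrightarrow>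
      (\<lambda>k. measure (T j) (choice_event j (\<lambda>t. \<rho> j n (Y (r k) j t)) s \<inter> G)) \<longlonglongrightarrow>
      measure (T j) (choice_event j (Z n j) s \<inter> G)"
    and lim: "\<And>j t. j \<in> I \<Longrightarrow> t \<in> space (T j) \<Longrightarrow> (\<lambda>n. Z n j t) \<longlonglongrightarrow> f j t"
    using limit_profile[of Y] Y by blast
  have "pay i (f(i := g)) \<le> pay i f" if i: "i \<in> I" and g: "g \<in> strat i" for i g
  proof -
    define d where "d k t = \<rho> i k (g t)" for k t
    have d: "d k \<in> strat i" for k unfolding d_def[abs_def] by (rule \<rho>_strat[OF i g])
    have gA: "g t \<in> A i" if "t \<in> space (T i)" for t using strat_in_A[OF g that] .
    have 1: "(\<lambda>k. pay i (Y (r k))) \<longlonglongrightarrow> pay i f"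
      by (rule payoff_tendsto[OF i Y Z ZX f conv lim])
    have 2: "(\<lambda>k. pay i ((Y (r k))(i := d (r k)))) \<longlonglongrightarrow> pay i (f(i := g))"
    proof (rule payoff_tendsto[OF i, where Z="\<lambda>n. (Z n)(i := d n)"])
      show "((Y (r k))(i := d (r k))) j \<in> strat j" "((Z n)(i := d n)) j \<in> strat j" "(f(i := g)) j \<in> strat j"
        if "j \<in> I" for k n j using that Y Z f d g by auto
      show "((Z n)(i := d n)) j t \<in> \<rho> j n ` A j" if "j \<in> I" "t \<in> space (T j)" for n j t
        using that ZX gA by (auto simp: d_def)
      show "(\<lambda>k. measure (T j) (choice_event j (\<lambda>t. \<rho> j n (((Y (r k))(i := d (r k))) j t)) s \<inter> G)) \<longlonglongrightarrow>
          measure (T j) (choice_event j (((Z n)(i := d n)) j) s \<inter> G)"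
        if j: "j \<in> I" "s \<in> \<rho> j n ` A j" "G \<in> sets (F j)" for j n s G
      proof (cases "j = i")
        case True
        \<comment> \<open>Once \<open>r k \<ge> n\<close>, discretizing \<open>g\<close> first at
          level \<open>r k\<close> and then at level \<open>n\<close> is the same as discretizing at
          level \<open>n\<close> directly. The deviator's conditional laws are thus eventually
          constant in \<open>k\<close>.\<close>
        have "choice_event i (\<lambda>t. \<rho> i n (d (r k) t)) s = choice_event i (d n) s" if "n \<le> k" for k
        proof -
          have "n \<le> r k" using that seq_suble[OF r, of k] by simp
          then show ?thesis using \<rho>_\<rho>[OF i _ gA] by (auto simp: choice_event_def d_def)
        qed
        then have "\<forall>\<^sub>F k in sequentially. measure (T i) (choice_event i (\<lambda>t. \<rho> i n (d (r k) t)) s \<inter> G) =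
            measure (T i) (choice_event i (d n) s \<inter> G)"
          by (intro eventually_sequentiallyI[of n]) simp
        then show ?thesis using True by (auto intro: tendsto_eventually)
      next
        case False
        then show ?thesis using conv[OF j] by simp
      qed
      show "(\<lambda>n. ((Z n)(i := d n)) j t) \<longlonglongrightarrow> (f(i := g)) j t" if j: "j \<in> I" "t \<in> space (T j)" for j t
      proof (cases "j = i")
        case True
        have "(\<lambda>n. d n t) \<longlonglongrightarrow> g t"
        proof (rule metric_LIMSEQ_I)
          fix e :: real assume "e > 0"
          then show "\<exists>N. \<forall>n\<ge>N. dist (d n t) (g t) < e"
            using \<rho>_close[OF i] gA j True unfolding d_def by blast
        qed
        then show ?thesis using True by simp
      qed (use lim[OF j] in simp)
    qed
    have 3: "(\<lambda>k. pay i (Y (r k)) + 1 / real (Suc (r k))) \<longlonglongrightarrow> pay i f + 0"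
      using LIMSEQ_subseq_LIMSEQ[OF LIMSEQ_Suc[OF lim_1_over_n] r]
      by (intro tendsto_add 1) (simp add: o_def)
    have "pay i ((Y (r k))(i := d (r k))) \<le> pay i (Y (r k)) + 1 / real (Suc (r k))" for k
      using gA by (intro eq[OF i d]) (auto simp: d_def)
    then show ?thesis using LIMSEQ_le[OF 2 3] by simp
  qed
  then show ?thesis using f unfolding pure_equilibrium_def by blast
qed

end

theorem theorem1:
  fixes I :: "'i set"
    and A :: "'i \<Rightarrow> 'a::metric_space set"
    and T :: "'i \<Rightarrow> 't measure"
    and F :: "'i \<Rightarrow> 't measure"
    and lam :: "('i \<Rightarrow> 't) measure"
    and u :: "'i \<Rightarrow> ('i \<Rightarrow> 'a) \<Rightarrow> 't \<Rightarrow> real"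
  assumes players: "finite I" "I \<noteq> {}"
    and actions_compact: "\<forall>i\<in>I. compact (A i)"
    and actions_uncountable: "\<forall>i\<in>I. uncountable (A i)"
    and info_prob: "\<forall>i\<in>I. prob_space (T i)"
    and info_complete: "\<forall>i\<in>I. complete_measure (T i)"
    and info_atomless: "\<forall>i\<in>I. atomless (T i)"
    and F_sub: "\<forall>i\<in>I. subalgebra (T i) (F i)"
    \<comment> \<open>Assumption (I)\<close>
    and assm_I: "lam = PiM I T"
    \<comment> \<open>Assumption (P')\<close>
    and P_countgen: "\<forall>i\<in>I. countably_generated (F i)"
    and P_meas: "\<forall>i\<in>I. case_prod (u i) \<in>
                   borel_measurable (PiM I (\<lambda>j. action_space (A j)) \<Otimes>\<^sub>M F i)"
    and P_cont: "\<forall>i\<in>I. \<forall>t\<in>space (T i). continuous_on (PiE I A) (\<lambda>a. u i a t)"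
    and P_bound: "\<forall>i\<in>I. \<exists>h. h \<in> borel_measurable (F i) \<and>
                   integrable (restr_to_subalg (T i) (F i)) h \<and>
                   (\<forall>a\<in>PiE I A. \<forall>t\<in>space (T i). \<bar>u i a t\<bar> \<le> h t)"
    \<comment> \<open>Assumption (RD)\<close>
    and RD: "\<forall>i\<in>I. atomless (T i) \<and> nowhere_equivalent (T i) (F i)"
  shows "\<exists>f. pure_equilibrium I A T lam u f"
  proof -
  obtain i0 where i0: "i0 \<in> I" using players by blast
  define T' where "T' i = (if i \<in> I then T i else T i0)" for i
  define F' where "F' i = (if i \<in> I then F i else F i0)" for i
  have info: "nowhere_equivalent_subalgebra (T' i) (F' i)" for i
    using info_prob F_sub RD i0
    by (auto simp: T'_def F'_def nowhere_equivalent_subalgebra_def nowhere_equivalent_subalgebra_axioms_def)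
  obtain h where h: "\<And>i. i \<in> I \<Longrightarrow> integrable (restr_to_subalg (T i) (F i)) (h i)"
    "\<And>i a t. i \<in> I \<Longrightarrow> a \<in> PiE I A \<Longrightarrow> t \<in> space (T i) \<Longrightarrow> \<bar>u i a t\<bar> \<le> h i t"
    using P_bound by metis
  define P where "P i \<rho> \<longleftrightarrow> (\<forall>n. \<rho> n \<in> measurable (action_space (A i)) (action_space (A i))) \<and>
    (\<forall>n. finite (\<rho> n ` A i)) \<and> (\<forall>n k. \<forall>a\<in>A i. n \<le> k \<longrightarrow> \<rho> n (\<rho> k a) = \<rho> n a) \<and>
    (\<forall>\<epsilon>>0. \<exists>N. \<forall>n\<ge>N. \<forall>a\<in>A i. dist (\<rho> n a) a < \<epsilon>)"
    for i and \<rho> :: "nat \<Rightarrow> 'a \<Rightarrow> 'a"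
  have "\<forall>i\<in>I. \<exists>\<rho>. P i \<rho>"
  proof
    fix i assume "i \<in> I"
    then have "compact (A i)" using actions_compact by blast
    then obtain \<rho> :: "nat \<Rightarrow> 'a \<Rightarrow> 'a" where "\<And>n. \<rho> n \<in> measurable (action_space (A i)) (action_space (A i))"
      "\<And>n. finite (\<rho> n ` A i)" "\<And>n k a. n \<le> k \<Longrightarrow> a \<in> A i \<Longrightarrow> \<rho> n (\<rho> k a) = \<rho> n a"
      "\<And>\<epsilon>. \<epsilon> > 0 \<Longrightarrow> \<exists>N. \<forall>n\<ge>N. \<forall>a\<in>A i. dist (\<rho> n a) a < \<epsilon>"
      by (rule compact_finite_range_retractions[folded action_space_def]) (rule that, blast+)
    then have "P i \<rho>" unfolding P_def by blast
    then show "\<exists>\<rho>. P i \<rho>" by blast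
  qed
  then obtain \<rho> where \<rho>: "\<And>i. i \<in> I \<Longrightarrow> P i (\<rho> i)" by metis
  interpret incomplete_information_game I A T' F' u h \<rho>
  proof (rule incomplete_information_game.intro)
    show "nowhere_equivalent_subalgebra (T' i) (F' i)" for i by (rule info)
    show "countably_generated (F' i)" for i using P_countgen i0 by (simp add: F'_def)
    show "A i \<noteq> {}" if "i \<in> I" for i using actions_uncountable that by force
    show "case_prod (u i) \<in> borel_measurable (PiM I (\<lambda>j. action_space (A j)) \<Otimes>\<^sub>M F' i)" if "i \<in> I" for i
      using P_meas that by (simp add: F'_def)
    show "continuous_on (PiE I A) (\<lambda>a. u i a t)" if "i \<in> I" "t \<in> space (T' i)" for i t
      using P_cont that by (simp add: T'_def)
    show "integrable (T' i) (h i)" if "i \<in> I" for i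
      using integrable_from_subalg[OF _ h(1)[OF that]] F_sub that by (simp add: T'_def)
    show "\<bar>u i a t\<bar> \<le> h i t" if "i \<in> I" "a \<in> PiE I A" "t \<in> space (T' i)" for i a t
      using h(2) that by (simp add: T'_def)
    show "\<rho> i n \<in> measurable (action_space (A i)) (action_space (A i))" "finite (\<rho> i n ` A i)"
      if "i \<in> I" for i n using \<rho>[OF that] by (simp_all add: P_def)
    show "\<rho> i n (\<rho> i k a) = \<rho> i n a" if "i \<in> I" "n \<le> k" "a \<in> A i" for i n k a
      using \<rho>[OF that(1)] that(2,3) by (simp add: P_def)
    show "\<exists>N. \<forall>n\<ge>N. \<forall>a\<in>A i. dist (\<rho> i n a) a < \<epsilon>" if "i \<in> I" "\<epsilon> > 0" for i \<epsilon>
      using \<rho>[OF that(1)] that(2) by (simp add: P_def)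
  qed (use players actions_compact in auto)
  \<comment> \<open>Product measure and equilibrium condition look only at indices in
    \<open>I\<close>, where \<open>T'\<close> and \<open>T\<close> agree.\<close>
  have "lam = PiM I T'" unfolding assm_I by (rule PiM_cong) (simp_all add: T'_def)
  then obtain f where "pure_equilibrium I A T' lam u f" using pure_equilibrium_exists by auto
  then have "pure_equilibrium I A T lam u f" by (simp add: pure_equilibrium_def T'_def)
  then show ?thesis by blast
qed

end
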